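(* Let $\tilde M$ be either the full mass matrix $M$ or the lumped mass matrix $M_{lump}$ of the linear finite element discretization, and let $A$ be the stiffness matrix. Then the eigenvalues of $\tilde M^{-1}A$ are real and positive. Moreover, the largest eigenvalue is bounded by $$\max_i \frac{A_{ii}}{\tilde M_{ii}} \le \lambda_{\max}\bigl(\tilde M^{-1}A\bigr) \le C_* \max_i \frac{A_{ii}}{\tilde M_{ii}},$$ where the constant $C_*$ is given as follows. For general meshes, $C_* = 2(d+1)$ if $\tilde M = M$ and $C_* = d+1$ if $\tilde M = M_{lump}$. For meshes that are nonobtuse with respect to $\mathbb{D}^{-1}$, $C_*$ can be taken as $C_* = 4$ if $\tilde M = M$ and $C_* = 2$ if $\tilde M = M_{lump}$.
   Context: Setting. $d\ge 1$; $\Omega\subset\mathbb{R}^d$ is an interval or a bounded polygonal or polyhedral domain; $\partial\Omega=\Gamma_D\cup\Gamma_N$, where $\Gamma_D$ (Dirichlet part) has positive $(d-1)$-volume (for $d=1$: is nonempty). The diffusion matrix $\mathbb{D}=\mathbb{D}(x)$ is a symmetric and uniformly positive definite $d\times d$ matrix function on $\Omega$. $\mathcal{T}_h$ is an arbitrary (possibly nonuniform and anisotropic) conforming simplicial mesh of $\Omega$, with $\Gamma_D$ a union of element faces. $V^h$ is the space of continuous functions that are affine on each element $K\in\mathcal{T}_h$, and $V^h_D=\{v\in V^h: v=0 \text{ on }\Gamma_D\}$. $N_{vi}$ is the number of mesh vertices not lying on $\Gamma_D$ (interior vertices plus vertices associated with the Neumann boundary condition), and $\phi_1,\dots,\phi_{N_{vi}}$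 are the corresponding nodal (hat) basis functions, which form a basis of $V^h_D$. All indices $i,j$ run from $1$ to $N_{vi}$. Matrices. Mass matrix: $M_{ij}=\int_\Omega \phi_i\phi_j\,dx$. Stiffness matrix: $A_{ij}=\int_\Omega \nabla\phi_i\cdot\mathbb{D}\nabla\phi_j\,dx$. Lumped mass matrix: the diagonal matrix $M_{lump}$ with diagonal entries $M_{ii,lump}=\int_\Omega \phi_i\sum_{j=1}^{N_{vi}}\phi_j\,dx$. $\lambda_{\max}$ denotes the largest eigenvalue. Nonobtuse meshes. Let $\mathbb{D}_K=\frac{1}{|K|}\int_K\mathbb{D}\,dx$. The mesh is nonobtuse with respect to $\mathbb{D}^{-1}$ if no element $K$ has an obtuse (dihedral) angle when measured in the metric $\mathbb{D}_K^{-1}$; equivalently, for every $K\in\mathcal{T}_h$ and any two distinct vertices of $K$ with hat functions $\phi,\psi$ (including vertices on $\Gamma_D$), $(\nabla\phi|_K)^T\mathbb{D}_K\nabla\psi|_K\le 0$. *)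

theory Defs
  imports "HOL-Analysis.Analysis" "Jordan_Normal_Form.Spectral_Radius"
    "Jordan_Normal_Form.Gauss_Jordan_Elimination"
begin

text \<open>
  Points and coefficient matrices live in the types \<open>real^'n\<close> and \<open>real^'n^'n\<close> of HOL-Analysis, with
  \<open>d = CARD('n)\<close>.  The finite element matrices, whose size depends on the mesh, are matrices of
  Jordan_Normal_Form, indexed from \<open>0\<close>.
\<close>

section \<open>Domain, boundary and diffusion matrix\<close>

text \<open>
  For \<open>d = 1\<close> this describes exactly the bounded open intervals: a bounded nonempty connected open
  subset of the line has two boundary points, and these are polytopes of affine dimension \<open>0\<close>.
\<close>

definition polyhedral_domain :: "(real^'n) set \<Rightarrow> bool" where
  "polyhedral_domain \<Omega> \<longleftrightarrow>
     open \<Omega> \<and> connected \<Omega> \<and> bounded \<Omega> \<and> \<Omega> \<noteq> {} \<and>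
     (\<exists>\<P>. finite \<P> \<and> (\<forall>F\<in>\<P>. polytope F \<and> aff_dim F = int CARD('n) - 1) \<and> frontier \<Omega> = \<Union>\<P>)"

text \<open>
  Unnormalised \<open>s\<close>-dimensional Hausdorff (outer) measure; only its positivity matters below.  Since
  \<open>t ^ 0 = 1\<close> also for \<open>t = 0\<close>, the case \<open>s = 0\<close> is the counting measure, so that positive
  \<open>(d-1)\<close>-volume means nonempty when \<open>d = 1\<close>.  The case distinction makes empty
  members of a cover free for \<open>s = 0\<close>.
\<close>

definition hausdorff_measure :: "nat \<Rightarrow> 'a::metric_space set \<Rightarrow> ennreal" where
  "hausdorff_measure s A =
     (SUP \<delta>\<in>{0<..}. INF U\<in>{U :: nat \<Rightarrow> 'a set. A \<subseteq> (\<Union>i. U i) \<and> (\<forall>i. bounded (U i) \<and> diameter (U i) \<le> \<delta>)}.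
        \<Sum>i. if U i = {} then 0 else ennreal (diameter (U i) ^ s))"

text \<open>
  Integrability of the entries is implicit in the integrals defining the stiffness matrix and the
  element averages.
\<close>

definition diffusion_matrix :: "(real^'n) set \<Rightarrow> (real^'n \<Rightarrow> real^'n^'n) \<Rightarrow> bool" where
  "diffusion_matrix \<Omega> D \<longleftrightarrow>
     D absolutely_integrable_on \<Omega> \<and>
     (\<forall>x\<in>\<Omega>. Finite_Cartesian_Product.transpose (D x) = D x) \<and>
     (\<exists>\<alpha>>0. \<forall>x\<in>\<Omega>. \<forall>\<xi>. \<alpha> * (norm \<xi>)\<^sup>2 \<le> \<xi> \<bullet> (D x *v \<xi>))"

section \<open>Mesh and linear finite elements\<close>

definition simplicial_mesh :: "(real^'n) set \<Rightarrow> (real^'n) set set \<Rightarrow> bool" where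
  "simplicial_mesh \<Omega> \<T> \<longleftrightarrow>
     triangulation \<T> \<and> (\<forall>K\<in>\<T>. int CARD('n) simplex K) \<and> \<Union>\<T> = closure \<Omega>"

definition mesh_faces :: "'a::euclidean_space set set \<Rightarrow> 'a set set" where
  "mesh_faces \<T> = {F. \<exists>K\<in>\<T>. F facet_of K}"

definition mesh_vertices :: "'a::euclidean_space set set \<Rightarrow> 'a set" where
  "mesh_vertices \<T> = {a. \<exists>K\<in>\<T>. a extreme_point_of K}"

definition free_vertices :: "'a::euclidean_space set set \<Rightarrow> 'a set \<Rightarrow> 'a set" where
  "free_vertices \<T> \<Gamma>\<^sub>D = mesh_vertices \<T> - \<Gamma>\<^sub>D"

text \<open>The space \<open>V\<^sup>h\<close>; the values of its members outside \<open>\<Union>\<T>\<close> are arbitrary and never used.\<close>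

definition fe_space :: "'a::euclidean_space set set \<Rightarrow> ('a \<Rightarrow> real) set" where
  "fe_space \<T> = {v. continuous_on (\<Union>\<T>) v \<and> (\<forall>K\<in>\<T>. \<exists>g c. \<forall>x\<in>K. v x = g \<bullet> x + c)}"

text \<open>For a vertex \<open>a\<close> of a conforming mesh, the condition determines the function on \<open>\<Union>\<T>\<close>.\<close>

definition hat :: "'a::euclidean_space set set \<Rightarrow> 'a \<Rightarrow> 'a \<Rightarrow> real" where
  "hat \<T> a = (SOME v. v \<in> fe_space \<T> \<and> (\<forall>b\<in>mesh_vertices \<T>. v b = (if b = a then 1 else 0)))"

text \<open>
  A function of \<open>V\<^sup>h\<close> is differentiable in the interior of every element, hence almost everywhere
  in the domain; elsewhere the value is irrelevant.
\<close>

definition grad :: "('a::real_inner \<Rightarrow> real) \<Rightarrow> 'a \<Rightarrow> 'a" where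
  "grad f x = (THE g. GDERIV f x :> g)"

definition mean_diffusion :: "(real^'n \<Rightarrow> real^'n^'n) \<Rightarrow> (real^'n) set \<Rightarrow> real^'n^'n" where
  "mean_diffusion D K = (1 / measure lebesgue K) *\<^sub>R (LINT x:K|lebesgue. D x)"

text \<open>The gradients of hat functions are constant on \<open>interior K\<close>.\<close>

definition nonobtuse :: "(real^'n \<Rightarrow> real^'n^'n) \<Rightarrow> (real^'n) set set \<Rightarrow> bool" where
  "nonobtuse D \<T> \<longleftrightarrow>
     (\<forall>K\<in>\<T>. \<forall>a b. a extreme_point_of K \<longrightarrow> b extreme_point_of K \<longrightarrow> a \<noteq> b \<longrightarrow>
        (\<forall>x\<in>interior K. grad (hat \<T> a) x \<bullet> (mean_diffusion D K *v grad (hat \<T> b) x) \<le> 0))"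

section \<open>Finite element matrices\<close>

definition mass_mat :: "'a::euclidean_space set \<Rightarrow> nat \<Rightarrow> (nat \<Rightarrow> 'a \<Rightarrow> real) \<Rightarrow> real mat" where
  "mass_mat \<Omega> N \<phi> = Matrix.mat N N (\<lambda>(i, j). LINT x:\<Omega>|lebesgue. \<phi> i x * \<phi> j x)"

definition lumped_mass_mat :: "'a::euclidean_space set \<Rightarrow> nat \<Rightarrow> (nat \<Rightarrow> 'a \<Rightarrow> real) \<Rightarrow> real mat" where
  "lumped_mass_mat \<Omega> N \<phi> = Matrix.mat N N (\<lambda>(i, j).
     if i = j then LINT x:\<Omega>|lebesgue. \<phi> i x * (\<Sum>k<N. \<phi> k x) else 0)"

definition stiffness_mat ::
    "(real^'n) set \<Rightarrow> (real^'n \<Rightarrow> real^'n^'n) \<Rightarrow> nat \<Rightarrow> (nat \<Rightarrow> real^'n \<Rightarrow> real) \<Rightarrow> real mat" where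
  "stiffness_mat \<Omega> D N \<phi> = Matrix.mat N N (\<lambda>(i, j).
     LINT x:\<Omega>|lebesgue. grad (\<phi> i) x \<bullet> (D x *v grad (\<phi> j) x))"

definition max_eigenvalue :: "real mat \<Rightarrow> real" where
  "max_eigenvalue B = Max (spectrum B)"

definition max_diag_ratio :: "real mat \<Rightarrow> real mat \<Rightarrow> real" where
  "max_diag_ratio A M = Max ((\<lambda>i. A $$ (i, i) / M $$ (i, i)) ` {..<dim_row A})"

end

theory Submission
  imports Defs
begin

text \<open>
  Both bounds come from the Rayleigh quotient \<open>u\<^sup>TAu / u\<^sup>TMu\<close>.  Its supremum is an eigenvalue of \<open>M\<^sup>-\<^sup>1A\<close>, and its
  value at the unit vectors is the ratio of diagonal entries, which yields the lower bound.  For the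
  upper bound it suffices to compare both matrices with their diagonals: if \<open>u\<^sup>TAu \<le> C \<Sum>A\<^sub>i\<^sub>iu\<^sub>i\<^sup>2\<close> and
  \<open>c \<Sum>M\<^sub>i\<^sub>iu\<^sub>i\<^sup>2 \<le> u\<^sup>TMu\<close>, then every eigenvalue is at most \<open>C / c\<close> times the largest ratio.  This linear
  algebra is \<open>generalized_eigenvalue_bounds\<close>.

  The two comparisons hold element by element, because all matrices are sums of element matrices
  (\<open>bilin_form_assembled\<close>).  For the stiffness matrix, \<open>d + 1\<close> vectors in a nonnegative quadratic form give
  \<open>C = d + 1\<close> (\<open>positive_form_le_card_diagonal\<close>).  On a nonobtuse mesh the element matrix has nonpositive
  off-diagonal entries, and its rows sum to zero because the hat functions of an element sum to one;
  such a matrix is bounded by twice its diagonal, so \<open>C = 2\<close> (\<open>zero_row_sum_le_twice_diagonal\<close>).  The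
  lumped mass matrix is its own diagonal, so \<open>c = 1\<close>.  The element mass matrix is a multiple of \<open>I + J\<close>
  with the all-ones matrix \<open>J\<close>, so \<open>c = 1 / 2\<close> (\<open>half_diagonal_le_mass_form\<close>).  Its shape follows from the
  second moments of the barycentric coordinates of a simplex (\<open>bary_moments\<close>), which are computed by
  slicing the simplex into homothetic copies of itself.

  Reality and positivity of the eigenvalues follow from symmetry and definiteness.  The mass matrices
  are definite by the comparison with their diagonals.  The stiffness matrix is definite because a
  finite element function with zero gradient is constant on the connected domain and vanishes on the
  Dirichlet part (\<open>stiffness_positive_definite\<close>).
\<close>

section \<open>Eigenvalues of a pencil of symmetric matrices\<close>

definition mat_apply :: "nat \<Rightarrow> real mat \<Rightarrow> (nat \<Rightarrow> real) \<Rightarrow> nat \<Rightarrow> real" where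
  "mat_apply n X u i = (\<Sum>j<n. X $$ (i, j) * u j)"

definition bilin_form :: "nat \<Rightarrow> real mat \<Rightarrow> (nat \<Rightarrow> real) \<Rightarrow> (nat \<Rightarrow> real) \<Rightarrow> real" where
  "bilin_form n X u v = (\<Sum>i<n. u i * mat_apply n X v i)"

lemma mat_apply_mult:
  assumes "X \<in> carrier_mat n n" "Y \<in> carrier_mat n n" "i < n"
  shows "mat_apply n (X * Y) u i = mat_apply n X (mat_apply n Y u) i"
proof -
  have "mat_apply n (X * Y) u i = (\<Sum>j<n. \<Sum>k<n. X $$ (i, k) * Y $$ (k, j) * u j)"
    using assms by (simp add: mat_apply_def scalar_prod_def atLeast0LessThan sum_distrib_right)
  also have "\<dots> = (\<Sum>k<n. \<Sum>j<n. X $$ (i, k) * Y $$ (k, j) * u j)"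
    by (rule sum.swap)
  finally show ?thesis
    by (simp add: mat_apply_def sum_distrib_left mult.assoc)
qed

lemma mat_apply_add: "mat_apply n X (\<lambda>i. u i + t * w i) i = mat_apply n X u i + t * mat_apply n X w i"
  by (simp add: mat_apply_def algebra_simps sum.distrib sum_distrib_left)

lemma bilin_form_sym:
  assumes "\<And>i j. i < n \<Longrightarrow> j < n \<Longrightarrow> X $$ (i, j) = X $$ (j, i)"
  shows "bilin_form n X u v = bilin_form n X v u"
proof -
  have "bilin_form n X u v = (\<Sum>i<n. \<Sum>j<n. u i * (X $$ (i, j) * v j))"
    by (simp add: bilin_form_def mat_apply_def sum_distrib_left)
  also have "\<dots> = (\<Sum>j<n. \<Sum>i<n. u i * (X $$ (i, j) * v j))"
    by (rule sum.swap)
  also have "\<dots> = (\<Sum>j<n. \<Sum>i<n. v j * (X $$ (j, i) * u i))"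
    using assms by (intro sum.cong refl) (auto simp: mult_ac)
  finally show ?thesis by (simp add: bilin_form_def mat_apply_def sum_distrib_left)
qed

lemma bilin_form_add:
  assumes "\<And>i j. i < n \<Longrightarrow> j < n \<Longrightarrow> X $$ (i, j) = X $$ (j, i)"
  shows "bilin_form n X (\<lambda>i. u i + t * w i) (\<lambda>i. u i + t * w i)
    = bilin_form n X u u + 2 * t * bilin_form n X u w + t\<^sup>2 * bilin_form n X w w"
proof -
  have "bilin_form n X (\<lambda>i. u i + t * w i) (\<lambda>i. u i + t * w i)
     = bilin_form n X u u + t * bilin_form n X u w + t * bilin_form n X w u + t\<^sup>2 * bilin_form n X w w"
    by (simp add: bilin_form_def mat_apply_add algebra_simps sum.distrib sum_distrib_left power2_eq_square)
  then show ?thesis using bilin_form_sym[of n X u w, OF assms] by simp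
qed

lemma bilin_form_le_sum_squares: "bilin_form n X u u \<le> (\<Sum>i<n. \<Sum>j<n. \<bar>X $$ (i, j)\<bar>) * (\<Sum>k<n. (u k)\<^sup>2)"
proof -
  let ?Q = "\<Sum>k<n. (u k)\<^sup>2"
  have "u i * (X $$ (i, j) * u j) \<le> \<bar>X $$ (i, j)\<bar> * ?Q" if "i < n" "j < n" for i j
  proof -
    have sq: "(u k)\<^sup>2 \<le> ?Q" if "k < n" for k
      using that by (intro member_le_sum) auto
    have "\<bar>u i * u j\<bar> \<le> ((u i)\<^sup>2 + (u j)\<^sup>2) / 2"
      using sum_squares_bound[of "\<bar>u i\<bar>" "\<bar>u j\<bar>"] by (simp add: abs_mult)
    also have "\<dots> \<le> ?Q"
      using sq[OF that(1)] sq[OF that(2)] by simp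
    finally have "\<bar>X $$ (i, j)\<bar> * \<bar>u i * u j\<bar> \<le> \<bar>X $$ (i, j)\<bar> * ?Q"
      by (rule mult_left_mono) simp
    moreover have "u i * (X $$ (i, j) * u j) \<le> \<bar>X $$ (i, j)\<bar> * \<bar>u i * u j\<bar>"
      unfolding abs_mult[symmetric] by (rule order_trans[OF abs_ge_self]) (simp add: mult_ac)
    ultimately show ?thesis by linarith
  qed
  then have "(\<Sum>i<n. \<Sum>j<n. u i * (X $$ (i, j) * u j)) \<le> (\<Sum>i<n. \<Sum>j<n. \<bar>X $$ (i, j)\<bar> * ?Q)"
    by (intro sum_mono) auto
  then show ?thesis
    by (simp only: bilin_form_def mat_apply_def sum_distrib_left[of "u _"] sum_distrib_right[symmetric])
qed

lemma mult_mat_vec_eq_mat_apply: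
  "X \<in> carrier_mat n n \<Longrightarrow> v \<in> carrier_vec n \<Longrightarrow> i < n \<Longrightarrow>
    vec_index (X *\<^sub>v v) i = mat_apply n X (vec_index v) i"
  by (simp add: mat_apply_def scalar_prod_def atLeast0LessThan)

lemma eigenvalue_inverse_mult_iff:
  fixes A M W :: "'a::field mat"
  assumes "A \<in> carrier_mat n n" "M \<in> carrier_mat n n" "W \<in> carrier_mat n n"
    and WM: "W * M = 1\<^sub>m n" and MW: "M * W = 1\<^sub>m n"
  shows "eigenvalue (W * A) \<mu> \<longleftrightarrow>
    (\<exists>v\<in>carrier_vec n. v \<noteq> 0\<^sub>v n \<and> A *\<^sub>v v = \<mu> \<cdot>\<^sub>v (M *\<^sub>v v))"
proof -
  have "(W * A) *\<^sub>v v = \<mu> \<cdot>\<^sub>v v \<longleftrightarrow> A *\<^sub>v v = \<mu> \<cdot>\<^sub>v (M *\<^sub>v v)" if v: "v \<in> carrier_vec n" for v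
  proof
    assume "(W * A) *\<^sub>v v = \<mu> \<cdot>\<^sub>v v"
    then have "M *\<^sub>v (W *\<^sub>v (A *\<^sub>v v)) = M *\<^sub>v (\<mu> \<cdot>\<^sub>v v)"
      using assms v by simp
    also have "M *\<^sub>v (W *\<^sub>v (A *\<^sub>v v)) = (M * W) *\<^sub>v (A *\<^sub>v v)"
      using assms v by (metis assoc_mult_mat_vec mult_mat_vec_carrier)
    finally show "A *\<^sub>v v = \<mu> \<cdot>\<^sub>v (M *\<^sub>v v)"
      using assms v by (simp add: MW mult_mat_vec[of _ n n])
  next
    assume *: "A *\<^sub>v v = \<mu> \<cdot>\<^sub>v (M *\<^sub>v v)"
    have "(W * A) *\<^sub>v v = W *\<^sub>v (\<mu> \<cdot>\<^sub>v (M *\<^sub>v v))"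
      using assms v by (simp flip: *)
    also have "\<dots> = \<mu> \<cdot>\<^sub>v (W *\<^sub>v (M *\<^sub>v v))"
      using assms v mult_mat_vec[of W n n "M *\<^sub>v v" \<mu>] by simp
    also have "W *\<^sub>v (M *\<^sub>v v) = (W * M) *\<^sub>v v"
      using assms(2,3) v by (metis assoc_mult_mat_vec)
    finally show "(W * A) *\<^sub>v v = \<mu> \<cdot>\<^sub>v v"
      using v by (simp add: WM)
  qed
  moreover have "dim_row (W * A) = n" using assms(3) by simp
  ultimately show ?thesis
    unfolding eigenvalue_def eigenvector_def by auto
qed

lemma real_eigenvalue_inverse_mult_iff:
  assumes "A \<in> carrier_mat n n" "M \<in> carrier_mat n n" "W \<in> carrier_mat n n"
    and "W * M = 1\<^sub>m n" and "M * W = 1\<^sub>m n"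
  shows "eigenvalue (W * A) \<mu> \<longleftrightarrow>
    (\<exists>u. (\<exists>i<n. u i \<noteq> 0) \<and> (\<forall>i<n. mat_apply n A u i = \<mu> * mat_apply n M u i))"
proof -
  have "(\<exists>v\<in>carrier_vec n. v \<noteq> 0\<^sub>v n \<and> A *\<^sub>v v = \<mu> \<cdot>\<^sub>v (M *\<^sub>v v)) \<longleftrightarrow>
    (\<exists>u. (\<exists>i<n. u i \<noteq> 0) \<and> (\<forall>i<n. mat_apply n A u i = \<mu> * mat_apply n M u i))" (is "?l \<longleftrightarrow> ?r")
  proof
    assume ?l
    then obtain v where v: "v \<in> carrier_vec n" "v \<noteq> 0\<^sub>v n" "A *\<^sub>v v = \<mu> \<cdot>\<^sub>v (M *\<^sub>v v)" by auto
    have "\<exists>i<n. vec_index v i \<noteq> 0"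
      using v(1,2) by (auto simp: Matrix.vec_eq_iff)
    moreover have "mat_apply n A (vec_index v) i = \<mu> * mat_apply n M (vec_index v) i" if "i < n" for i
      using arg_cong[OF v(3), of "\<lambda>w. vec_index w i"] assms(1,2) v(1) that
      by (simp add: mult_mat_vec_eq_mat_apply del: index_mult_mat_vec)
    ultimately show ?r by blast
  next
    assume ?r
    then obtain u where u: "\<exists>i<n. u i \<noteq> 0" "\<forall>i<n. mat_apply n A u i = \<mu> * mat_apply n M u i" by blast
    let ?v = "Matrix.vec n u"
    have cong: "mat_apply n X (vec_index ?v) = mat_apply n X u" for X
      by (auto simp: mat_apply_def)
    have "?v \<noteq> 0\<^sub>v n"
      using u(1) by (auto simp: Matrix.vec_eq_iff)
    moreover have "A *\<^sub>v ?v = \<mu> \<cdot>\<^sub>v (M *\<^sub>v ?v)"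
      using assms(1,2) u(2)
      by (intro Matrix.eq_vecI) (auto simp: mult_mat_vec_eq_mat_apply cong simp del: index_mult_mat_vec)
    ultimately show ?l by (intro bexI[of _ ?v]) auto
  qed
  then show ?thesis
    using eigenvalue_inverse_mult_iff[OF assms] by simp
qed

lemma singular_imp_kernel:
  assumes "X \<in> carrier_mat n n" "Determinant.det X = 0"
  obtains u where "\<exists>i<n. u i \<noteq> 0" "\<And>i. i < n \<Longrightarrow> mat_apply n X u i = 0"
proof -
  obtain v where v: "v \<in> carrier_vec n" "v \<noteq> 0\<^sub>v n" "X *\<^sub>v v = 0\<^sub>v n"
    using assms det_0_iff_vec_prod_zero by blast
  show thesis
  proof (rule that[of "vec_index v"])
    show "\<exists>i<n. vec_index v i \<noteq> 0"
      using v(1,2) by (auto simp: Matrix.vec_eq_iff)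
    show "mat_apply n X (vec_index v) i = 0" if "i < n" for i
      using mult_mat_vec_eq_mat_apply[OF assms(1) v(1) that] v(3) that by simp
  qed
qed

lemma nonsingular_imp_mat_inverse:
  fixes X :: "real mat"
  assumes "X \<in> carrier_mat n n" "Determinant.det X \<noteq> 0"
  obtains W where "mat_inverse X = Some W" "W \<in> carrier_mat n n" "X * W = 1\<^sub>m n" "W * X = 1\<^sub>m n"
proof -
  have "X \<in> Units (ring_mat TYPE(real) n ())"
    using assms by (rule det_non_zero_imp_unit)
  then obtain W where W: "mat_inverse X = Some W"
    using mat_inverse(1)[OF assms(1), of "()"] by fastforce
  then show thesis using mat_inverse(2)[OF assms(1) W] that by blast
qed

text \<open>
  The supremum \<open>\<rho>\<close> of the Rayleigh quotient \<open>u\<^sup>TAu / u\<^sup>TMu\<close> is an eigenvalue, which a purely algebraic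
  argument shows without compactness of the unit sphere.  The matrix \<open>B = \<rho>M - A\<close> is positive
  semidefinite.  If it were nonsingular, then with \<open>w = B\<^sup>-\<^sup>1Mu\<close> the inequality
  \<open>0 \<le> (u - tw)\<^sup>TB(u - tw) = u\<^sup>TBu - 2t u\<^sup>TMu + t\<^sup>2 w\<^sup>TBw\<close>, where \<open>w\<^sup>TBw \<le> C u\<^sup>TMu\<close>, would give
  \<open>u\<^sup>TBu \<ge> u\<^sup>TMu / C\<close> for \<open>t = 1 / C\<close>, so that \<open>\<rho> - 1 / C\<close> would also bound the quotient.
\<close>

lemma generalized_eigenvalue_of_Sup:
  assumes n: "n > 0" and car: "A \<in> carrier_mat n n" "M \<in> carrier_mat n n"
    and Asym: "\<And>i j. i < n \<Longrightarrow> j < n \<Longrightarrow> A $$ (i, j) = A $$ (j, i)"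
    and Msym: "\<And>i j. i < n \<Longrightarrow> j < n \<Longrightarrow> M $$ (i, j) = M $$ (j, i)"
    and m: "m > 0" "\<And>u. m * (\<Sum>k<n. (u k)\<^sup>2) \<le> bilin_form n M u u"
  obtains \<rho> u where "\<exists>i<n. u i \<noteq> 0" "\<And>i. i < n \<Longrightarrow> mat_apply n A u i = \<rho> * mat_apply n M u i"
    "\<And>u. bilin_form n A u u \<le> \<rho> * bilin_form n M u u"
proof -
  define nz where "nz u \<longleftrightarrow> (\<exists>i<n. u i \<noteq> 0)" for u :: "nat \<Rightarrow> real"
  have sqpos: "0 < (\<Sum>k<n. (u k)\<^sup>2)" if "nz u" for u
    using that unfolding nz_def by (force intro: sum_pos2)
  have Mpos: "0 < bilin_form n M u u" if "nz u" for u
    using m(2)[of u] mult_pos_pos[OF m(1) sqpos[OF that]] by linarith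
  have zero: "bilin_form n X u u = 0" if "\<not> nz u" for X u
    using that by (auto simp: bilin_form_def nz_def)
  have dom: "\<exists>C>0. \<forall>u. bilin_form n X u u \<le> C * bilin_form n M u u" for X
  proof -
    define S where "S = (\<Sum>i<n. \<Sum>j<n. \<bar>X $$ (i, j)\<bar>) + 1"
    have S: "S > 0" unfolding S_def by (intro add_nonneg_pos sum_nonneg) auto
    have "bilin_form n X u u \<le> S / m * bilin_form n M u u" for u
    proof -
      have "bilin_form n X u u \<le> S * (\<Sum>k<n. (u k)\<^sup>2)"
        using bilin_form_le_sum_squares[of n X u] sum_nonneg[of "{..<n}" "\<lambda>k. (u k)\<^sup>2"]
        by (simp add: S_def algebra_simps)
      also have "\<dots> = S / m * (m * (\<Sum>k<n. (u k)\<^sup>2))" using m(1) by simp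
      also have "\<dots> \<le> S / m * bilin_form n M u u"
        using S m by (intro mult_left_mono) auto
      finally show ?thesis .
    qed
    then show ?thesis using S m(1) by (intro exI[of _ "S / m"]) auto
  qed
  define R where "R = {bilin_form n A u u / bilin_form n M u u |u. nz u}"
  define \<rho> where "\<rho> = Sup R"
  have "R \<noteq> {}" using n by (auto simp: R_def nz_def intro: exI[of _ "\<lambda>_. 1"])
  have "bdd_above R"
  proof -
    obtain C where "\<And>u. bilin_form n A u u \<le> C * bilin_form n M u u" using dom[of A] by blast
    then have "bilin_form n A u u / bilin_form n M u u \<le> C" if "nz u" for u
      using Mpos[OF that] by (simp add: pos_divide_le_eq)
    then show ?thesis
      by (auto simp: R_def bdd_above_def)
  qed
  have le: "bilin_form n A u u \<le> \<rho> * bilin_form n M u u" for u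
  proof (cases "nz u")
    case True
    then have "bilin_form n A u u / bilin_form n M u u \<le> \<rho>"
      unfolding \<rho>_def using \<open>bdd_above R\<close> by (intro cSup_upper) (auto simp: R_def)
    then show ?thesis using Mpos[OF True] by (simp add: divide_simps)
  qed (simp add: zero)
  define B where "B = \<rho> \<cdot>\<^sub>m M - A"
  have Bcar: "B \<in> carrier_mat n n" unfolding B_def using car by (intro carrier_matI) auto
  have Bent: "B $$ (i, j) = \<rho> * M $$ (i, j) - A $$ (i, j)" if "i < n" "j < n" for i j
    using car that by (simp add: B_def)
  have Bsym: "B $$ (i, j) = B $$ (j, i)" if "i < n" "j < n" for i j
    using that by (simp add: Bent Asym[OF that] Msym[OF that])
  have Bfun: "mat_apply n B u i = \<rho> * mat_apply n M u i - mat_apply n A u i" if "i < n" for u i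
    using that by (simp add: mat_apply_def Bent algebra_simps sum_subtractf sum_distrib_left)
  have Bbil: "bilin_form n B u u = \<rho> * bilin_form n M u u - bilin_form n A u u" for u
    by (simp add: bilin_form_def Bfun algebra_simps sum_subtractf sum_distrib_left)
  have "Determinant.det B = 0"
  proof (rule ccontr)
    assume "Determinant.det B \<noteq> 0"
    then obtain P where P: "P \<in> carrier_mat n n" "B * P = 1\<^sub>m n"
      using nonsingular_imp_mat_inverse[OF Bcar] by blast
    \<comment> \<open>The matrix of the form \<open>w\<^sup>TBw = (PMu)\<^sup>TMu\<close> in \<open>u\<close>.\<close>
    define Q where "Q = transpose_mat (P * M) * M"
    obtain C where C: "C > 0" "\<And>u. bilin_form n Q u u \<le> C * bilin_form n M u u" using dom[of Q] by blast
    have gap: "bilin_form n M u u / C \<le> bilin_form n B u u" for u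
    proof -
      define w where "w = mat_apply n P (mat_apply n M u)"
      have Bw: "mat_apply n B w i = mat_apply n M u i" if "i < n" for i
      proof -
        have "mat_apply n B w i = mat_apply n (B * P) (mat_apply n M u) i"
          using mat_apply_mult[OF Bcar P(1) that] by (simp add: w_def)
        also have "\<dots> = (\<Sum>j<n. if j = i then mat_apply n M u j else 0)"
          unfolding P(2) mat_apply_def[of n "1\<^sub>m n"] using that by (intro sum.cong) auto
        also have "\<dots> = mat_apply n M u i" using that by simp
        finally show ?thesis .
      qed
      have Buw: "bilin_form n B u w = bilin_form n M u u" by (simp add: bilin_form_def Bw)
      have "bilin_form n B w w = (\<Sum>i<n. mat_apply n (P * M) u i * mat_apply n M u i)"
        unfolding bilin_form_def using car P by (intro sum.cong) (simp_all add: Bw mat_apply_mult, simp add: w_def)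
      also have "\<dots> = (\<Sum>i<n. \<Sum>j<n. (P * M) $$ (i, j) * u j * mat_apply n M u i)"
        by (simp add: mat_apply_def[of n "P * M"] sum_distrib_right)
      also have "\<dots> = (\<Sum>j<n. \<Sum>i<n. (P * M) $$ (i, j) * u j * mat_apply n M u i)"
        by (rule sum.swap)
      also have "\<dots> = (\<Sum>j<n. u j * mat_apply n (transpose_mat (P * M)) (mat_apply n M u) j)"
        using car P unfolding mat_apply_def[of n "transpose_mat (P * M)"]
        by (intro sum.cong refl) (auto simp: sum_distrib_left mult_ac intro!: sum.cong simp del: index_mult_mat(1))
      also have "\<dots> = bilin_form n Q u u"
        unfolding bilin_form_def Q_def using car P by (intro sum.cong refl) (subst mat_apply_mult[where n=n], auto)
      finally have Bww: "bilin_form n B w w \<le> C * bilin_form n M u u" using C(2)[of u] by simp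
      have "0 \<le> bilin_form n B (\<lambda>i. u i + - (1 / C) * w i) (\<lambda>i. u i + - (1 / C) * w i)"
        using le[of "\<lambda>i. u i + - (1 / C) * w i"] unfolding Bbil by simp
      also have "\<dots> = bilin_form n B u u - 2 / C * bilin_form n M u u + (1 / C)\<^sup>2 * bilin_form n B w w"
        using bilin_form_add[of n B u "- (1 / C)" w, OF Bsym] Buw by simp
      also have "\<dots> \<le> bilin_form n B u u - 2 / C * bilin_form n M u u + (1 / C)\<^sup>2 * (C * bilin_form n M u u)"
        using Bww by (intro add_left_mono mult_left_mono) auto
      also have "\<dots> = bilin_form n B u u - bilin_form n M u u / C"
        using C(1) by (simp add: field_simps power2_eq_square)
      finally show ?thesis by simp
    qed
    have "\<rho> \<le> \<rho> - 1 / C"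
      unfolding \<rho>_def
    proof (rule cSup_least[OF \<open>R \<noteq> {}\<close>])
      fix r assume "r \<in> R"
      then obtain u where u: "nz u" "r = bilin_form n A u u / bilin_form n M u u" by (auto simp: R_def)
      have "bilin_form n A u u \<le> (\<rho> - 1 / C) * bilin_form n M u u"
        using gap[of u] unfolding Bbil by (simp add: algebra_simps)
      then show "r \<le> Sup R - 1 / C"
        using Mpos[OF u(1)] unfolding u(2) \<rho>_def[symmetric] by (simp add: pos_divide_le_eq)
    qed
    then show False using C(1) by simp
  qed
  then obtain u where "\<exists>i<n. u i \<noteq> 0" "\<And>i. i < n \<Longrightarrow> mat_apply n B u i = 0"
    using singular_imp_kernel[OF Bcar] by blast
  then show thesis using that[of u \<rho>] le Bfun by force
qed

lemma bilin_form_unit: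
  "i < n \<Longrightarrow> bilin_form n X (\<lambda>k. if k = i then 1 else 0) (\<lambda>k. if k = i then 1 else 0) = X $$ (i, i)"
  by (simp add: bilin_form_def mat_apply_def if_distrib if_distribR cong: if_cong)

text \<open>
  The linear algebra behind the theorem.  All spectral information is in the Rayleigh quotient: the unit
  vectors give the lower bound, because the supremum is attained at an eigenvalue; an eigenvector \<open>u\<close>
  for \<open>\<mu>\<close> gives \<open>\<mu> u\<^sup>TMu = u\<^sup>TAu \<le> C \<Sum>A\<^sub>i\<^sub>iu\<^sub>i\<^sup>2 \<le> C r \<Sum>M\<^sub>i\<^sub>iu\<^sub>i\<^sup>2 \<le> (C / c) r u\<^sup>TMu\<close> with the largest ratio \<open>r\<close> of
  diagonal entries.  Thus it only remains to compare both matrices with their diagonals.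
\<close>

theorem generalized_eigenvalue_bounds:
  assumes n: "n > 0" and car: "A \<in> carrier_mat n n" "M \<in> carrier_mat n n"
    and Asym: "\<And>i j. i < n \<Longrightarrow> j < n \<Longrightarrow> A $$ (i, j) = A $$ (j, i)"
    and Msym: "\<And>i j. i < n \<Longrightarrow> j < n \<Longrightarrow> M $$ (i, j) = M $$ (j, i)"
    and Apos: "\<And>u. \<exists>i<n. u i \<noteq> 0 \<Longrightarrow> 0 < bilin_form n A u u"
    and Mdiag: "\<And>i. i < n \<Longrightarrow> 0 < M $$ (i, i)"
    and c: "c > 0" "\<And>u. c * (\<Sum>i<n. M $$ (i, i) * (u i)\<^sup>2) \<le> bilin_form n M u u"
  defines "B \<equiv> the (mat_inverse M) * A"
  shows "invertible_mat M"
    and "\<And>\<mu>. eigenvalue (map_mat complex_of_real B) \<mu> \<Longrightarrow> \<mu> \<in> \<real> \<and> Re \<mu> > 0"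
    and "max_diag_ratio A M \<le> max_eigenvalue B"
    and "\<And>C. C \<ge> 0 \<Longrightarrow> (\<And>u. bilin_form n A u u \<le> C * (\<Sum>i<n. A $$ (i, i) * (u i)\<^sup>2)) \<Longrightarrow>
      max_eigenvalue B \<le> C / c * max_diag_ratio A M"
proof -
  have Mpos: "0 < bilin_form n M u u" if "\<exists>i<n. u i \<noteq> 0" for u
  proof -
    have "0 < (\<Sum>i<n. M $$ (i, i) * (u i)\<^sup>2)"
      using that Mdiag by (force intro: sum_pos2 simp: less_imp_le)
    then show ?thesis using c(2)[of u] mult_pos_pos[OF c(1)] by (meson less_le_trans)
  qed
  have "Determinant.det M \<noteq> 0"
  proof
    assume "Determinant.det M = 0"
    then obtain u where u: "\<exists>i<n. u i \<noteq> 0" "\<And>i. i < n \<Longrightarrow> mat_apply n M u i = 0"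
      using singular_imp_kernel[OF car(2)] by blast
    then show False using Mpos[OF u(1)] by (simp add: bilin_form_def)
  qed
  then obtain W where W: "mat_inverse M = Some W" "W \<in> carrier_mat n n" "M * W = 1\<^sub>m n" "W * M = 1\<^sub>m n"
    using nonsingular_imp_mat_inverse[OF car(2)] by blast
  show "invertible_mat M"
    using W car unfolding invertible_mat_def inverts_mat_def by auto
  have B: "B = W * A" by (simp add: B_def W(1))
  have Bcar: "B \<in> carrier_mat n n" using W(2) car(1) by (simp add: B)
  note eig = real_eigenvalue_inverse_mult_iff[OF car W(2,4,3)]

  show "\<mu> \<in> \<real> \<and> Re \<mu> > 0" if "eigenvalue (map_mat complex_of_real B) \<mu>" for \<mu>
  proof -
    let ?c = "map_mat complex_of_real"
    have "?c W * ?c M = ?c (W * M)" "?c M * ?c W = ?c (M * W)" "?c B = ?c W * ?c A"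
      using W(2) car by (simp_all add: B of_real_hom.mat_hom_mult)
    then have "?c W * ?c M = 1\<^sub>m n" "?c M * ?c W = 1\<^sub>m n" "?c B = ?c W * ?c A"
      by (simp_all add: W(3,4) of_real_hom.mat_hom_one)
    note inv = this
    have "eigenvalue (?c W * ?c A) \<mu>"
      using that unfolding inv(3) .
    then obtain v where v: "v \<in> carrier_vec n" "v \<noteq> 0\<^sub>v n" "?c A *\<^sub>v v = \<mu> \<cdot>\<^sub>v (?c M *\<^sub>v v)"
      using eigenvalue_inverse_mult_iff[OF _ _ _ inv(1,2), of "?c A" \<mu>] W(2) car by auto
    \<comment> \<open>For symmetric \<open>X\<close> and \<open>v = x + iy\<close>, the number \<open>v\<^sup>*Xv = x\<^sup>TXx + y\<^sup>TXy\<close> is real.\<close>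
    define x where "x i = Re (vec_index v i)" for i
    define y where "y i = Im (vec_index v i)" for i
    have quad: "(\<Sum>i<n. cnj (vec_index v i) * vec_index (?c X *\<^sub>v v) i) = of_real (bilin_form n X x x + bilin_form n X y y)"
      if X: "X \<in> carrier_mat n n" "\<And>i j. i < n \<Longrightarrow> j < n \<Longrightarrow> X $$ (i, j) = X $$ (j, i)" for X
    proof -
      have idx: "vec_index (?c X *\<^sub>v v) i = Complex (mat_apply n X x i) (mat_apply n X y i)" if "i < n" for i
        using X(1) v(1) that
        by (auto simp: complex_eq_iff scalar_prod_def mat_apply_def x_def y_def atLeast0LessThan intro!: sum.cong)
      have "(\<Sum>i<n. cnj (vec_index v i) * vec_index (?c X *\<^sub>v v) i)
          = (\<Sum>i<n. Complex (x i * mat_apply n X x i + y i * mat_apply n X y i)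
              (x i * mat_apply n X y i - y i * mat_apply n X x i))"
        by (intro sum.cong refl) (auto simp: idx complex_eq_iff x_def y_def)
      also have "\<dots> = Complex (bilin_form n X x x + bilin_form n X y y) (bilin_form n X x y - bilin_form n X y x)"
        by (simp add: complex_eq_iff bilin_form_def sum.distrib sum_subtractf)
      also have "bilin_form n X x y = bilin_form n X y x" by (rule bilin_form_sym[OF X(2)])
      finally show ?thesis by (simp add: complex_eq_iff)
    qed
    define a m where "a = bilin_form n A x x + bilin_form n A y y" and "m = bilin_form n M x x + bilin_form n M y y"
    have "of_real a = (\<Sum>i<n. cnj (vec_index v i) * vec_index (?c A *\<^sub>v v) i)"
      by (simp add: a_def quad[OF car(1) Asym])
    also have "\<dots> = \<mu> * (\<Sum>i<n. cnj (vec_index v i) * vec_index (?c M *\<^sub>v v) i)"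
      unfolding v(3) using car(2) v(1) by (simp add: sum_distrib_left mult_ac)
    also have "\<dots> = \<mu> * of_real m"
      by (simp add: m_def quad[OF car(2) Msym])
    finally have am: "of_real a = \<mu> * of_real m" .
    have nz: "(\<exists>i<n. x i \<noteq> 0) \<or> (\<exists>i<n. y i \<noteq> 0)"
      using v(1,2) by (auto simp: Matrix.vec_eq_iff x_def y_def complex_eq_iff)
    have pos: "0 < bilin_form n X x x + bilin_form n X y y" if "\<And>u. \<exists>i<n. u i \<noteq> 0 \<Longrightarrow> 0 < bilin_form n X u u" for X
    proof -
      have "0 \<le> bilin_form n X u u" for u
        using that[of u] by (cases "\<exists>i<n. u i \<noteq> 0") (auto simp: bilin_form_def)
      then show ?thesis
        using nz that by (metis add_nonneg_pos add_pos_nonneg)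
    qed
    have am0: "a > 0" "m > 0"
      unfolding a_def m_def using pos[OF Apos] pos[OF Mpos] by auto
    then have "\<mu> = of_real (a / m)" using am by (simp add: field_simps)
    then show ?thesis using am0 by simp
  qed

  have fin: "finite (spectrum B)"
    using card_finite_spectrum(1)[OF Bcar] .
  have ratio: "A $$ (i, i) / M $$ (i, i) \<le> max_diag_ratio A M" if "i < n" for i
    unfolding max_diag_ratio_def using that car by (intro Max_ge) auto
  have "\<exists>m>0. \<forall>u. m * (\<Sum>k<n. (u k)\<^sup>2) \<le> bilin_form n M u u"
  proof -
    define m where "m = Min ((\<lambda>i. M $$ (i, i)) ` {..<n})"
    have "m > 0" unfolding m_def using n Mdiag by (subst Min_gr_iff) auto
    moreover have "c * m * (\<Sum>k<n. (u k)\<^sup>2) \<le> bilin_form n M u u" for u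
    proof -
      have "m * (\<Sum>k<n. (u k)\<^sup>2) \<le> (\<Sum>i<n. M $$ (i, i) * (u i)\<^sup>2)"
        unfolding sum_distrib_left m_def by (intro sum_mono mult_right_mono Min_le) auto
      then have "c * (m * (\<Sum>k<n. (u k)\<^sup>2)) \<le> c * (\<Sum>i<n. M $$ (i, i) * (u i)\<^sup>2)"
        using c(1) by (intro mult_left_mono) auto
      then show ?thesis using c(2)[of u] by (simp add: mult.assoc)
    qed
    ultimately show ?thesis using c(1) by (intro exI[of _ "c * m"]) auto
  qed
  then obtain m where m: "m > 0" "\<And>u. m * (\<Sum>k<n. (u k)\<^sup>2) \<le> bilin_form n M u u" by blast
  obtain \<rho> w where \<rho>: "\<exists>i<n. w i \<noteq> 0" "\<And>i. i < n \<Longrightarrow> mat_apply n A w i = \<rho> * mat_apply n M w i"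
    "\<And>u. bilin_form n A u u \<le> \<rho> * bilin_form n M u u"
    using generalized_eigenvalue_of_Sup[OF n car Asym Msym m] by metis
  have "\<rho> \<in> spectrum B"
    using eig[of \<rho>] \<rho>(1,2) unfolding spectrum_def B by blast
  then have \<rho>le: "\<rho> \<le> max_eigenvalue B"
    unfolding max_eigenvalue_def using fin by (rule Max_ge[rotated])

  show "max_diag_ratio A M \<le> max_eigenvalue B"
    unfolding max_diag_ratio_def
  proof (rule Max.boundedI)
    fix r assume "r \<in> (\<lambda>i. A $$ (i, i) / M $$ (i, i)) ` {..<dim_row A}"
    then obtain i where i: "i < n" "r = A $$ (i, i) / M $$ (i, i)" using car by auto
    have "A $$ (i, i) \<le> \<rho> * M $$ (i, i)"
      using \<rho>(3)[of "\<lambda>k. if k = i then 1 else 0"] unfolding bilin_form_unit[OF i(1)] .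
    then show "r \<le> max_eigenvalue B"
      using \<rho>le Mdiag[OF i(1)] i(2) by (simp add: pos_divide_le_eq)
        (meson less_imp_le mult_right_mono order_trans)
  qed (use n car in auto)

  fix C :: real assume C: "C \<ge> 0" "\<And>u. bilin_form n A u u \<le> C * (\<Sum>i<n. A $$ (i, i) * (u i)\<^sup>2)"
  show "max_eigenvalue B \<le> C / c * max_diag_ratio A M"
    unfolding max_eigenvalue_def
  proof (rule Max.boundedI[OF fin])
    show "spectrum B \<noteq> {}" using \<open>\<rho> \<in> spectrum B\<close> by blast
    fix \<mu> assume "\<mu> \<in> spectrum B"
    then obtain u where u: "\<exists>i<n. u i \<noteq> 0" "\<forall>i<n. mat_apply n A u i = \<mu> * mat_apply n M u i"
      using eig[of \<mu>] unfolding spectrum_def B by blast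
    let ?r = "max_diag_ratio A M"
    have Adiag: "A $$ (i, i) \<ge> 0" if "i < n" for i
    proof -
      have "\<exists>k<n. (if k = i then 1 else 0 :: real) \<noteq> 0" using that by auto
      from Apos[OF this] show ?thesis unfolding bilin_form_unit[OF that] by simp
    qed
    have r0: "?r \<ge> 0"
      using ratio[of 0] n Adiag[of 0] Mdiag[of 0] by (meson divide_nonneg_pos order_trans)
    have "\<mu> * bilin_form n M u u = bilin_form n A u u"
      using u(2) by (simp add: bilin_form_def sum_distrib_left mult_ac)
    also have "\<dots> \<le> C * (\<Sum>i<n. A $$ (i, i) * (u i)\<^sup>2)" by (rule C(2))
    also have "\<dots> \<le> C * (\<Sum>i<n. ?r * (M $$ (i, i) * (u i)\<^sup>2))"
    proof (intro mult_left_mono[OF _ C(1)] sum_mono)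
      fix i assume "i \<in> {..<n}"
      then have "A $$ (i, i) \<le> ?r * M $$ (i, i)"
        using ratio[of i] Mdiag[of i] by (simp add: pos_divide_le_eq)
      then show "A $$ (i, i) * (u i)\<^sup>2 \<le> ?r * (M $$ (i, i) * (u i)\<^sup>2)"
        unfolding mult.assoc[symmetric] by (rule mult_right_mono) simp
    qed
    also have "\<dots> = C / c * ?r * (c * (\<Sum>i<n. M $$ (i, i) * (u i)\<^sup>2))"
      using c(1) by (simp add: sum_distrib_left)
    also have "\<dots> \<le> C / c * ?r * bilin_form n M u u"
      using c C(1) r0 by (intro mult_left_mono) auto
    finally show "\<mu> \<le> C / c * ?r"
      using Mpos[OF u(1)] by (meson mult_le_cancel_right_pos)
  qed
qed

section \<open>Barycentric coordinates\<close>

text \<open>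
  The gradient of the barycentric coordinate of the vertex \<open>a\<close> of the simplex with vertex set \<open>V\<close>.
\<close>

definition bary_grad :: "'a::euclidean_space set \<Rightarrow> 'a \<Rightarrow> 'a" where
  "bary_grad V a = (SOME g. \<forall>b\<in>V. 1 + g \<bullet> (b - a) = (if b = a then 1 else 0))"

text \<open>
  Taken as an affine function on the whole space, so that the simplex is the set where all
  coordinates are nonnegative and the coordinates can be composed with affine maps.
\<close>

definition bary :: "'a::euclidean_space set \<Rightarrow> 'a \<Rightarrow> 'a \<Rightarrow> real" where
  "bary V a x = 1 + bary_grad V a \<bullet> (x - a)"

definition full_simplex :: "'a::euclidean_space set \<Rightarrow> bool" where
  "full_simplex V \<longleftrightarrow> \<not> affine_dependent V \<and> card V = DIM('a) + 1"

lemma full_simplex_finite: "full_simplex V \<Longrightarrow> finite V"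
  unfolding full_simplex_def using card.infinite by fastforce

lemma bary_vertex:
  assumes "full_simplex V" "a \<in> V" "b \<in> V"
  shows "bary V a b = (if b = a then 1 else 0)"
proof -
  have "independent ((\<lambda>x. - a + x) ` (V - {a}))"
    using assms affine_dependent_iff_dependent2 unfolding full_simplex_def by blast
  then obtain f :: "'a \<Rightarrow> real" where f: "linear f"
    "\<And>y. y \<in> (\<lambda>x. - a + x) ` (V - {a}) \<Longrightarrow> f y = -1"
    using linear_independent_extend[of _ "\<lambda>_. -1"] by blast
  define g where "g = (\<Sum>b\<in>Basis. f b *\<^sub>R b)"
  have fg: "f x = g \<bullet> x" for x
  proof -
    have "f x = f (\<Sum>b\<in>Basis. (b \<bullet> x) *\<^sub>R b)" by (simp add: euclidean_representation inner_commute[of _ x])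
    also have "\<dots> = g \<bullet> x"
      using f(1) by (simp add: linear_sum linear_scale g_def inner_sum_left mult.commute)
    finally show ?thesis .
  qed
  have "\<forall>b\<in>V. 1 + g \<bullet> (b - a) = (if b = a then 1 else 0)"
    using f(2) linear_0[OF f(1)] by (auto simp flip: fg simp: image_iff)
  then have "\<forall>b\<in>V. 1 + bary_grad V a \<bullet> (b - a) = (if b = a then 1 else 0)"
    unfolding bary_grad_def by (rule someI)
  then show ?thesis using assms(3) by (simp add: bary_def)
qed

lemma bary_affine_comb:
  assumes "finite I" "sum u I = 1"
  shows "bary V a (\<Sum>i\<in>I. u i *\<^sub>R y i) = (\<Sum>i\<in>I. u i * bary V a (y i))"
proof -
  have "(\<Sum>i\<in>I. u i * bary V a (y i))
      = (\<Sum>i\<in>I. u i) + bary_grad V a \<bullet> (\<Sum>i\<in>I. u i *\<^sub>R y i) - (\<Sum>i\<in>I. u i) * (bary_grad V a \<bullet> a)"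
    by (simp add: bary_def algebra_simps sum.distrib sum_subtractf inner_sum_right sum_distrib_right sum_distrib_left)
  then show ?thesis using assms(2) by (simp add: bary_def algebra_simps)
qed

lemma bary_of_affine_comb:
  assumes "full_simplex V" "a \<in> V" "sum u V = 1"
  shows "bary V a (\<Sum>b\<in>V. u b *\<^sub>R b) = u a"
proof -
  have "(\<Sum>b\<in>V. u b * bary V a b) = (\<Sum>b\<in>V. if b = a then u b else 0)"
    using assms by (intro sum.cong) (auto simp: bary_vertex)
  then show ?thesis
    using assms full_simplex_finite[OF assms(1)] bary_affine_comb[of V u V a "\<lambda>b. b"] by simp
qed

lemma affine_combination_of_vertices:
  assumes "full_simplex V"
  shows bary_sum: "(\<Sum>a\<in>V. bary V a x) = 1"
    and bary_combination: "(\<Sum>a\<in>V. bary V a x *\<^sub>R a) = x"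
proof -
  have "affine hull V = UNIV"
    using assms affine_independent_span_eq unfolding full_simplex_def by fastforce
  then obtain u where u: "sum u V = 1" "(\<Sum>b\<in>V. u b *\<^sub>R b) = x"
    using affine_hull_finite[OF full_simplex_finite[OF assms]] by auto
  have "bary V a x = u a" if "a \<in> V" for a
    using bary_of_affine_comb[OF assms that u(1)] u(2) by simp
  then show "(\<Sum>a\<in>V. bary V a x) = 1" "(\<Sum>a\<in>V. bary V a x *\<^sub>R a) = x"
    using u by simp_all
qed

lemma convex_hull_eq_bary_nonneg:
  assumes "full_simplex V"
  shows "convex hull V = {x. \<forall>a\<in>V. 0 \<le> bary V a x}"
proof (intro equalityI subsetI)
  fix x assume "x \<in> convex hull V"
  then obtain u where "\<forall>b\<in>V. 0 \<le> u b" "sum u V = 1" "(\<Sum>b\<in>V. u b *\<^sub>R b) = x"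
    using convex_hull_finite[OF full_simplex_finite[OF assms]] by auto
  then show "x \<in> {x. \<forall>a\<in>V. 0 \<le> bary V a x}"
    using bary_of_affine_comb[OF assms] by auto
next
  fix x assume "x \<in> {x. \<forall>a\<in>V. 0 \<le> bary V a x}"
  then show "x \<in> convex hull V"
    using convex_hull_finite[OF full_simplex_finite[OF assms]] affine_combination_of_vertices[OF assms, of x]
    by (auto intro!: exI[of _ "\<lambda>a. bary V a x"])
qed

lemma bary_le_1:
  assumes "full_simplex V" "a \<in> V" "x \<in> convex hull V"
  shows "bary V a x \<le> 1"
proof -
  have "bary V a x \<le> (\<Sum>a\<in>V. bary V a x)"
    using assms convex_hull_eq_bary_nonneg[OF assms(1)] full_simplex_finite
    by (intro member_le_sum) auto
  then show ?thesis using bary_sum[OF assms(1)] by simp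
qed

lemma bary_diff: "bary V a x - bary V a y = bary_grad V a \<bullet> (x - y)"
  by (simp add: bary_def algebra_simps)

text \<open>
  The coordinates sum to one, so this vector is orthogonal to every displacement, itself included.
\<close>

lemma sum_bary_grad:
  assumes "full_simplex V"
  shows "(\<Sum>a\<in>V. bary_grad V a) = 0"
proof -
  let ?g = "\<Sum>a\<in>V. bary_grad V a"
  have "?g \<bullet> (?g - 0) = (\<Sum>a\<in>V. bary V a ?g - bary V a 0)"
    unfolding bary_diff by (simp add: inner_sum_left)
  also have "\<dots> = 0" using bary_sum[OF assms] by (simp add: sum_subtractf)
  finally show ?thesis by simp
qed

lemma continuous_on_bary [continuous_intros]:
  "continuous_on S f \<Longrightarrow> continuous_on S (\<lambda>x. bary V a (f x))"
  unfolding bary_def by (intro continuous_intros)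

lemma compact_full_simplex: "full_simplex V \<Longrightarrow> compact (convex hull V)"
  using full_simplex_finite compact_convex_hull finite_imp_compact by blast

section \<open>Second moments of barycentric coordinates\<close>

text \<open>
  Fubini's theorem on the compact region \<open>{(x, s). x \<in> K, 0 \<le> s \<le> l x}\<close>.
\<close>

lemma layer_cake:
  fixes K :: "'a::euclidean_space set"
  assumes K: "compact K" and l: "continuous_on K l" and f: "continuous_on K f"
    and l01: "\<And>x. x \<in> K \<Longrightarrow> 0 \<le> l x \<and> l x \<le> (1::real)"
  shows "(LINT x:K|lborel. l x * f x) = (LINT s:{0..1}|lborel. LINT x:{x\<in>K. s \<le> l x}|lborel. (f x :: real))"
proof -
  define C where "C = {z \<in> K \<times> {0..1}. snd z \<le> l (fst z)}"
  have cl: "continuous_on (K \<times> {0..1::real}) (\<lambda>z. l (fst z))" "continuous_on (K \<times> {0..1::real}) (\<lambda>z. f (fst z))"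
    by (auto intro!: continuous_on_compose2[OF l] continuous_on_compose2[OF f] continuous_intros)
  have "compact C"
  proof -
    have "closedin (top_of_set (K \<times> {0..1})) (K \<times> {0..1} \<inter> (\<lambda>z. snd z - l (fst z)) -` {..0})"
      by (intro continuous_closedin_preimage continuous_intros cl closed_atMost)
    also have "K \<times> {0..1} \<inter> (\<lambda>z. snd z - l (fst z)) -` {..0} = C"
      by (auto simp: C_def)
    finally have "closedin (top_of_set (K \<times> {0..1})) C" .
    then show ?thesis
      using K closedin_compact compact_Times compact_Icc by blast
  qed
  moreover have "continuous_on C (\<lambda>z. f (fst z))"
    using cl(2) by (rule continuous_on_subset) (auto simp: C_def)
  ultimately have int: "integrable lborel (\<lambda>z. indicator C z *\<^sub>R f (fst z))"
    by (rule borel_integrable_compact)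
  define F where "F x s = indicator C (x, s) *\<^sub>R f x" for x s
  have "integrable (lborel \<Otimes>\<^sub>M lborel) (case_prod F)"
    using int by (simp add: lborel_prod F_def case_prod_beta')
  from lborel_pair.Fubini_integral[OF this]
  have "(LINT s|lborel. LINT x|lborel. F x s) = (LINT x|lborel. LINT s|lborel. F x s)" .
  moreover have "(LINT s|lborel. F x s) = indicator K x *\<^sub>R (l x * f x)" for x
  proof (cases "x \<in> K")
    case True
    have "F x = (\<lambda>s. indicator {0..l x} s *\<^sub>R f x)"
      using l01[OF True] True by (auto simp: F_def C_def indicator_def)
    then show ?thesis
      using True l01[OF True] by simp
  qed (simp add: F_def C_def)
  moreover have "(LINT x|lborel. F x s)
      = indicator {0..1} s *\<^sub>R (LINT x:{x\<in>K. s \<le> l x}|lborel. f x)" for s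
  proof (cases "s \<in> {0..1}")
    case True
    then have "F x s = indicator {x\<in>K. s \<le> l x} x *\<^sub>R f x" for x
      by (auto simp: F_def C_def indicator_def)
    then show ?thesis
      using True by (simp add: set_lebesgue_integral_def)
  qed (auto simp: F_def C_def)
  ultimately show ?thesis
    by (simp add: set_lebesgue_integral_def)
qed

lemma set_integral_homothety:
  fixes a :: "'a::euclidean_space" and f :: "'a \<Rightarrow> real"
  assumes "r > 0" "S \<in> sets borel" "f \<in> borel_measurable borel"
  shows "(LINT x:S|lborel. f x) = r ^ DIM('a) * (LINT x:{x. a + r *\<^sub>R (x - a) \<in> S}|lborel. f (a + r *\<^sub>R (x - a)))"
proof -
  let ?h = "\<lambda>x. (a - r *\<^sub>R a) + r *\<^sub>R x"
  have h: "?h x = a + r *\<^sub>R (x - a)" for x by (simp add: algebra_simps)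
  have [measurable]: "?h \<in> borel_measurable borel" by measurable
  note [measurable] = assms(2,3)
  have [measurable]: "(\<lambda>x. indicator S x *\<^sub>R f x) \<in> borel_measurable borel" by measurable
  have "(LINT x:S|lborel. f x) = (LINT x|density (distr lborel borel ?h) (\<lambda>_. \<bar>r\<bar> ^ DIM('a)). indicator S x *\<^sub>R f x)"
    unfolding set_lebesgue_integral_def using assms(1) by (subst lborel_affine[of r "a - r *\<^sub>R a"]) auto
  also have "\<dots> = (LINT x|distr lborel borel ?h. r ^ DIM('a) * (indicator S x *\<^sub>R f x))"
    using assms(1) by (subst integral_density) (auto simp: ennreal_power)
  also have "\<dots> = (LINT x|lborel. r ^ DIM('a) * (indicator S (?h x) *\<^sub>R f (?h x)))"
    by (subst integral_distr) auto
  also have "\<dots> = r ^ DIM('a) * (LINT x:{x. ?h x \<in> S}|lborel. f (?h x))"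
    by (simp add: set_lebesgue_integral_def indicator_def)
  finally show ?thesis unfolding h .
qed

lemma bary_homothety: "bary V b (a + r *\<^sub>R (x - a)) = (1 - r) * bary V b a + r * bary V b x"
  by (simp add: bary_def algebra_simps)

text \<open>
  The part of a simplex where the coordinate of \<open>a\<close> is at least \<open>s\<close> is a copy of the simplex, shrunk
  towards \<open>a\<close> by the factor \<open>1 - s\<close>.
\<close>

lemma homothety_superlevel:
  assumes V: "full_simplex V" "a \<in> V" and s: "0 \<le> s" "s < 1"
  shows "a + (1 - s) *\<^sub>R (x - a) \<in> {y \<in> convex hull V. s \<le> bary V a y} \<longleftrightarrow> x \<in> convex hull V"
proof -
  let ?y = "a + (1 - s) *\<^sub>R (x - a)"
  have ya: "bary V a ?y = s + (1 - s) * bary V a x"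
    using bary_vertex[OF V(1) V(2,2)] by (simp add: bary_homothety)
  have yb: "bary V b ?y = (1 - s) * bary V b x" if "b \<in> V" "b \<noteq> a" for b
    using bary_vertex[OF V(1) that(1) V(2)] that(2) by (simp add: bary_homothety)
  have "(\<forall>b\<in>V. 0 \<le> bary V b ?y) \<and> s \<le> bary V a ?y \<longleftrightarrow> (\<forall>b\<in>V. 0 \<le> bary V b x)"
  proof (intro iffI conjI ballI)
    fix b assume *: "(\<forall>b\<in>V. 0 \<le> bary V b ?y) \<and> s \<le> bary V a ?y" "b \<in> V"
    show "0 \<le> bary V b x"
    proof (cases "b = a")
      case True
      then show ?thesis using * ya s by (simp add: zero_le_mult_iff)
    next
      case False
      then have "0 \<le> (1 - s) * bary V b x" using * yb[of b] by metis
      then show ?thesis using s by (simp add: zero_le_mult_iff)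
    qed
  next
    fix b assume *: "\<forall>b\<in>V. 0 \<le> bary V b x" "b \<in> V"
    show "0 \<le> bary V b ?y"
      using * s ya yb[of b] by (cases "b = a") (auto intro!: add_nonneg_nonneg mult_nonneg_nonneg)
  next
    assume "\<forall>b\<in>V. 0 \<le> bary V b x"
    then show "s \<le> bary V a ?y" unfolding ya using s V(2) by simp
  qed
  then show ?thesis by (simp add: convex_hull_eq_bary_nonneg[OF V(1)])
qed

lemma superlevel_integral:
  fixes V :: "'a::euclidean_space set"
  assumes V: "full_simplex V" "a \<in> V" and s: "0 \<le> s" "s < 1" and f: "continuous_on UNIV f"
  shows "(LINT x:{x \<in> convex hull V. s \<le> bary V a x}|lborel. f x)
    = (1 - s) ^ DIM('a) * (LINT x:convex hull V|lborel. (f (a + (1 - s) *\<^sub>R (x - a)) :: real))"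
proof -
  let ?S = "{x \<in> convex hull V. s \<le> bary V a x}"
  have "closed (convex hull V \<inter> {x. s \<le> bary V a x})"
    using compact_full_simplex[OF V(1)]
    by (intro closed_Int compact_imp_closed closed_Collect_le continuous_intros) auto
  then have "?S \<in> sets borel"
    by (simp add: Collect_conj_eq)
  then show ?thesis
    using set_integral_homothety[of "1 - s" ?S f a] s f homothety_superlevel[OF V s]
    by (simp add: borel_measurable_continuous_onI)
qed

lemma integral_one_minus_power:
  "(LINT s:{0..1}|lborel. (1 - s) ^ k) = 1 / (real k + 1)"
proof -
  have "(LINT s|lborel. indicator {0..1} s *\<^sub>R (1 - s) ^ k) = - ((1 - 1) ^ Suc k / (real k + 1)) - - ((1 - 0) ^ Suc k / (real k + 1))"
  proof (rule integral_FTC_Icc)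
    fix s :: real
    have "((\<lambda>s. (1 - s) ^ Suc k) has_real_derivative - ((real k + 1) * (1 - s) ^ k)) (at s within {0..1})"
      using DERIV_power[of "\<lambda>s. 1 - s" "-1" s "{0..1}" "Suc k"]
        DERIV_diff[OF DERIV_const[of 1] DERIV_ident, of s "{0..1}"]
      by (simp del: power_Suc add: algebra_simps)
    then have "((\<lambda>s. - ((1 - s) ^ Suc k / (real k + 1))) has_real_derivative
        - (- ((real k + 1) * (1 - s) ^ k) / (real k + 1))) (at s within {0..1})"
      by (intro DERIV_minus DERIV_cdivide)
    then show "((\<lambda>s. - ((1 - s) ^ Suc k / (real k + 1))) has_vector_derivative (1 - s) ^ k) (at s within {0..1})"
      unfolding has_real_derivative_iff_has_vector_derivative[symmetric] by simp
  qed (auto intro!: continuous_intros)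
  then show ?thesis by (simp add: set_lebesgue_integral_def)
qed

text \<open>
  Combining the layers with the homothety: the layer integral over \<open>{bary V c \<ge> s}\<close> is \<open>(1 - s)\<^sup>d\<close> times an
  integral over the whole simplex.  Applied to the constant \<open>1\<close> this gives the first moments, applied
  to another coordinate it reduces the second moments to the first ones.  For the inequality on the
  mass matrix it matters that the moments of squares are exactly twice the mixed ones.
\<close>

lemma bary_moments:
  fixes V :: "'a::euclidean_space set"
  assumes V: "full_simplex V" "a \<in> V" "b \<in> V"
  shows "(LINT x:convex hull V|lborel. bary V a x * bary V b x)
    = (if a = b then 2 else 1) * measure lborel (convex hull V) / ((DIM('a) + 1) * (DIM('a) + 2))"
proof -
  let ?K = "convex hull V" and ?d = "DIM('a)"
  let ?m = "measure lborel ?K"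
  have K: "compact ?K" by (rule compact_full_simplex[OF V(1)])
  have Kfin: "?K \<in> sets lborel" "emeasure lborel ?K \<noteq> \<infinity>"
    using K emeasure_compact_finite[OF K] by (auto simp: borel_compact)
  have bK: "0 \<le> bary V c x \<and> bary V c x \<le> 1" if "c \<in> V" "x \<in> ?K" for c x
    using that bary_le_1[OF V(1)] convex_hull_eq_bary_nonneg[OF V(1)] by auto
  have int: "set_integrable lborel ?K f" if "continuous_on UNIV f" for f :: "'a \<Rightarrow> real"
    unfolding set_integrable_def using K that continuous_on_subset by (blast intro: borel_integrable_compact)
  have pint: "set_integrable lborel {0..1} f" if "continuous_on UNIV f" for f :: "real \<Rightarrow> real"
    unfolding set_integrable_def using that continuous_on_subset by (blast intro: borel_integrable_compact compact_Icc)
  have layers: "(LINT x:?K|lborel. bary V c x * f x)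
      = (LINT s:{0..1}|lborel. (1 - s) ^ ?d * (LINT x:?K|lborel. f (c + (1 - s) *\<^sub>R (x - c))))"
    if c: "c \<in> V" and f: "continuous_on UNIV f" for c f
  proof -
    have "(LINT x:?K|lborel. bary V c x * f x) = (LINT s:{0..1}|lborel. LINT x:{x \<in> ?K. s \<le> bary V c x}|lborel. f x)"
      using K bK[OF c] f continuous_on_subset by (intro layer_cake continuous_intros) blast+
    also have "\<dots> = (LINT s:{0..1}|lborel. (1 - s) ^ ?d * (LINT x:?K|lborel. f (c + (1 - s) *\<^sub>R (x - c))))"
    proof (intro set_lebesgue_integral_cong ballI impI allI)
      fix s :: real assume s: "s \<in> {0..1}"
      show "(LINT x:{x \<in> ?K. s \<le> bary V c x}|lborel. f x) = (1 - s) ^ ?d * (LINT x:?K|lborel. f (c + (1 - s) *\<^sub>R (x - c)))"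
      \<comment> \<open>The homothety degenerates at \<open>s = 1\<close>, where the layer lies in the null set \<open>{c}\<close>.\<close>
      proof (cases "s = 1")
        case True
        have "{x \<in> ?K. 1 \<le> bary V c x} \<subseteq> {c}"
        proof safe
          fix x assume x: "x \<in> ?K" "1 \<le> bary V c x"
          have one: "bary V c x = 1" using bK[OF c x(1)] x(2) by simp
          have "sum (\<lambda>e. bary V e x) (V - {c}) = 0"
            using bary_sum[OF V(1), of x] one full_simplex_finite[OF V(1)] c by (simp add: sum.remove)
          then have "\<forall>e\<in>V - {c}. bary V e x = 0"
            using bK x(1) full_simplex_finite[OF V(1)] by (subst (asm) sum_nonneg_eq_0_iff) auto
          then have "(\<Sum>e\<in>V. bary V e x *\<^sub>R e) = c"
            using one full_simplex_finite[OF V(1)] c by (simp add: sum.remove)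
          then show "x = c" using bary_combination[OF V(1)] by simp
        qed
        then have "(LINT x:{x \<in> ?K. 1 \<le> bary V c x}|lborel. f x) = 0"
          unfolding set_lebesgue_integral_def using AE_lborel_singleton[of c]
          by (intro integral_eq_zero_AE) (auto elim!: eventually_mono simp: indicator_def)
        then show ?thesis
          using True by (simp add: power_0_left)
      next
        case False
        then show ?thesis using superlevel_integral[OF V(1) c _ _ f, of s] s by simp
      qed
    qed auto
    finally show ?thesis .
  qed
  have first: "(LINT x:?K|lborel. bary V c x) = ?m / (?d + 1)" if c: "c \<in> V" for c
  proof -
    have "(LINT x:?K|lborel. bary V c x) = (LINT s:{0..1}|lborel. (1 - s) ^ ?d * (LINT x:?K|lborel. 1))"
      using layers[OF c, of "\<lambda>_. 1"] by simp
    also have "\<dots> = ?m * (LINT s:{0..1}|lborel. (1 - s) ^ ?d)"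
      using Kfin by (simp add: mult.commute set_integral_const)
    finally show ?thesis by (simp add: integral_one_minus_power)
  qed
  define N where "N = ?m / (?d + 1)"
  have "(LINT x:?K|lborel. bary V a x * bary V b x)
      = (LINT s:{0..1}|lborel. (1 - s) ^ ?d * (LINT x:?K|lborel. s * bary V b a + (1 - s) * bary V b x))"
    by (subst layers[OF V(2)]) (auto intro!: continuous_intros simp: bary_homothety)
  also have "\<dots> = (LINT s:{0..1}|lborel. bary V b a * ?m * ((1 - s) ^ ?d - (1 - s) ^ (?d + 1))
      + N * (1 - s) ^ (?d + 1))"
  proof (intro set_lebesgue_integral_cong ballI impI allI)
    fix s :: real
    have "(LINT x:?K|lborel. s * bary V b a + (1 - s) * bary V b x)
        = (LINT x:?K|lborel. s * bary V b a) + (LINT x:?K|lborel. (1 - s) * bary V b x)"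
      by (intro set_integral_add int continuous_intros)
    also have "(LINT x:?K|lborel. s * bary V b a) = s * bary V b a * ?m"
      using Kfin by (simp add: set_integral_const mult.commute)
    also have "(LINT x:?K|lborel. (1 - s) * bary V b x) = (1 - s) * (N)"
      by (simp add: first[OF V(3)] N_def)
    finally have *: "(LINT x:?K|lborel. s * bary V b a + (1 - s) * bary V b x) = s * bary V b a * ?m + (1 - s) * N" .
    show "(1 - s) ^ ?d * (LINT x:?K|lborel. s * bary V b a + (1 - s) * bary V b x)
      = bary V b a * ?m * ((1 - s) ^ ?d - (1 - s) ^ (?d + 1)) + N * (1 - s) ^ (?d + 1)"
      unfolding * by (simp add: algebra_simps)
  qed auto
  also have "\<dots> = bary V b a * ?m * (1 / (?d + 1) - 1 / (?d + 2)) + N * (1 / (?d + 2))"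
    using integral_one_minus_power[of ?d] integral_one_minus_power[of "?d + 1"]
    by (simp only: set_integral_add(2) set_integral_diff(2) pint continuous_intros set_integral_mult_right)
       (simp add: add_ac)
  also have "\<dots> = (if a = b then 2 else 1) * ?m / ((?d + 1) * (?d + 2))"
    using bary_vertex[OF V(1) V(3,2)] by (simp add: N_def field_simps)
  finally show ?thesis .
qed

section \<open>Hat functions on elements\<close>

definition vertices :: "'a::euclidean_space set \<Rightarrow> 'a set" where
  "vertices K = {a. a extreme_point_of K}"

lemma mesh_element:
  fixes \<T> :: "(real^'n) set set"
  assumes "simplicial_mesh \<Omega> \<T>" "K \<in> \<T>"
  shows "full_simplex (vertices K)" "convex hull vertices K = K"
proof -
  have "int CARD('n) simplex K"
    using assms unfolding simplicial_mesh_def by blast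
  then obtain C where C: "\<not> affine_dependent C" "int (card C) = int CARD('n) + 1" "K = convex hull C"
    unfolding simplex_def by blast
  have "vertices K = C"
    unfolding vertices_def C(3) using extreme_point_of_convex_hull_affine_independent[OF C(1)] by blast
  then show "full_simplex (vertices K)" "convex hull vertices K = K"
    using C by (auto simp: full_simplex_def)
qed

lemma mesh_conforming:
  assumes "simplicial_mesh \<Omega> \<T>" "K \<in> \<T>" "L \<in> \<T>"
  shows "K \<inter> L face_of K"
  using assms unfolding simplicial_mesh_def triangulation_def by blast

lemma mesh_finite: "simplicial_mesh \<Omega> \<T> \<Longrightarrow> finite \<T>"
  and mesh_Union: "simplicial_mesh \<Omega> \<T> \<Longrightarrow> \<Union>\<T> = closure \<Omega>"
  unfolding simplicial_mesh_def triangulation_def by auto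

lemma mesh_vertices_eq: "mesh_vertices \<T> = (\<Union>K\<in>\<T>. vertices K)"
  by (auto simp: mesh_vertices_def vertices_def)

lemma mesh_compact:
  fixes \<T> :: "(real^'n) set set"
  assumes "simplicial_mesh \<Omega> \<T>" "K \<in> \<T>"
  shows "compact K" "convex K"
proof -
  show "compact K"
    using mesh_element[OF assms] compact_full_simplex by metis
  show "convex K"
    using mesh_element(2)[OF assms] convex_convex_hull by metis
qed

text \<open>
  The hat function of \<open>a\<close> as seen from the element \<open>K\<close>; it vanishes when \<open>a\<close> is not a vertex of \<open>K\<close>.
\<close>

definition nodal :: "'a::euclidean_space set \<Rightarrow> 'a \<Rightarrow> 'a \<Rightarrow> real" where
  "nodal K a x = (if a \<in> vertices K then bary (vertices K) a x else 0)"

lemma nodal_affine_comb: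
  assumes "finite I" "sum u I = 1"
  shows "nodal K a (\<Sum>i\<in>I. u i *\<^sub>R y i) = (\<Sum>i\<in>I. u i * nodal K a (y i))"
  using bary_affine_comb[OF assms, of "vertices K" a y] by (simp add: nodal_def)

lemma nodal_vertex:
  fixes \<T> :: "(real^'n) set set"
  assumes "simplicial_mesh \<Omega> \<T>" "K \<in> \<T>" "b \<in> vertices K"
  shows "nodal K a b = (if b = a then 1 else 0)"
  using assms bary_vertex[OF mesh_element(1)[OF assms(1,2)] _ assms(3)] by (auto simp: nodal_def)

text \<open>
  Two elements meet in a common face, by conformity.  A face is the convex hull of its vertices, which
  are vertices of both elements, and the two affine functions have the same values there.
\<close>

lemma nodal_agree:
  fixes \<T> :: "(real^'n) set set"
  assumes m: "simplicial_mesh \<Omega> \<T>" and K: "K \<in> \<T>" "L \<in> \<T>" and x: "x \<in> K" "x \<in> L"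
  shows "nodal K a x = nodal L a x"
proof -
  let ?F = "K \<inter> L"
  have face: "?F face_of K" "?F face_of L"
    using mesh_conforming[OF m K] mesh_conforming[OF m K(2,1)] by (simp_all add: Int_commute)
  have F: "vertices ?F \<subseteq> vertices K" "vertices ?F \<subseteq> vertices L"
    using extreme_point_of_face[OF face(1)] extreme_point_of_face[OF face(2)] by (auto simp: vertices_def)
  have "compact ?F" "convex ?F"
    using mesh_compact[OF m] K by (auto intro: compact_Int convex_Int)
  then have "x \<in> convex hull vertices ?F"
    using Krein_Milman_Minkowski[of ?F] x by (simp add: vertices_def)
  moreover have fin: "finite (vertices ?F)"
    using F(1) full_simplex_finite[OF mesh_element(1)[OF m K(1)]] finite_subset by blast
  ultimately obtain u where u: "sum u (vertices ?F) = 1" "(\<Sum>b\<in>vertices ?F. u b *\<^sub>R b) = x"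
    by (auto simp: convex_hull_finite)
  have "nodal K' a x = (\<Sum>b\<in>vertices ?F. u b * (if b = a then 1 else 0))"
    if "K' \<in> \<T>" "vertices ?F \<subseteq> vertices K'" for K'
    using nodal_affine_comb[OF fin u(1), of K' a "\<lambda>b. b"] u(2) nodal_vertex[OF m that(1)] that(2)
    by (auto intro!: sum.cong)
  then show ?thesis using K F by simp
qed

lemma affine_on_element:
  fixes \<T> :: "(real^'n) set set" and g :: "real^'n"
  assumes m: "simplicial_mesh \<Omega> \<T>" and K: "K \<in> \<T>" and x: "x \<in> K"
    and v: "\<And>x. x \<in> K \<Longrightarrow> v x = g \<bullet> x + c"
  shows "v x = (\<Sum>a\<in>vertices K. bary (vertices K) a x * v a)"
proof -
  note V = mesh_element(1)[OF m K]
  have vK: "a \<in> K" if "a \<in> vertices K" for a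
    using that by (simp add: vertices_def extreme_point_of_def)
  have "(\<Sum>a\<in>vertices K. bary (vertices K) a x * v a)
      = g \<bullet> (\<Sum>a\<in>vertices K. bary (vertices K) a x *\<^sub>R a) + c * (\<Sum>a\<in>vertices K. bary (vertices K) a x)"
    by (simp add: v[OF vK] algebra_simps inner_sum_right sum.distrib sum_distrib_left)
  then show ?thesis
    using v[OF x] bary_sum[OF V] bary_combination[OF V] by simp
qed

lemma continuous_nodal: "continuous_on S (nodal K a)"
  by (cases "a \<in> vertices K") (auto simp: nodal_def[abs_def] intro!: continuous_intros)

text \<open>
  The functions \<open>nodal K a\<close> on the finitely many closed elements agree on overlaps, so they glue to a
  continuous function.
\<close>

lemma hat_exists:
  fixes \<T> :: "(real^'n) set set"
  assumes m: "simplicial_mesh \<Omega> \<T>"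
  shows "\<exists>v. v \<in> fe_space \<T> \<and> (\<forall>b\<in>mesh_vertices \<T>. v b = (if b = a then 1 else 0))"
proof -
  obtain v where v: "continuous_on (\<Union>\<T>) v" "\<And>x K. K \<in> \<T> \<Longrightarrow> x \<in> K \<Longrightarrow> v x = nodal K a x"
  proof (rule pasting_lemma_exists_closed[of \<T> "top_of_set (\<Union>\<T>)" "\<lambda>K. K" euclideanreal "\<lambda>K. nodal K a"])
    show "finite \<T>" by (rule mesh_finite[OF m])
    show "closedin (top_of_set (\<Union>\<T>)) K" if "K \<in> \<T>" for K
      using compact_imp_closed[OF mesh_compact(1)[OF m that]] that by (intro closed_subset) auto
    show "nodal K a x = nodal L a x" if "K \<in> \<T>" "L \<in> \<T>" "x \<in> topspace (top_of_set (\<Union>\<T>)) \<inter> K \<inter> L" for K L x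
      using that by (intro nodal_agree[OF m that(1,2)]) auto
  next
    fix g assume g: "continuous_map (top_of_set (\<Union>\<T>)) euclideanreal g"
      "\<And>x K. K \<in> \<T> \<Longrightarrow> x \<in> topspace (top_of_set (\<Union>\<T>)) \<inter> K \<Longrightarrow> g x = nodal K a x"
    show thesis
      by (rule that[of g]) (use g in auto)
  qed (auto simp: subtopology_subtopology continuous_nodal)
  have "\<exists>g c. \<forall>x\<in>K. v x = g \<bullet> x + c" if "K \<in> \<T>" for K
  proof (cases "a \<in> vertices K")
    case True
    then have "\<forall>x\<in>K. v x = bary_grad (vertices K) a \<bullet> x + (1 - bary_grad (vertices K) a \<bullet> a)"
      by (simp add: v(2)[OF that] nodal_def bary_def inner_diff_right)
    then show ?thesis by blast
  next
    case False
    then have "\<forall>x\<in>K. v x = 0 \<bullet> x + 0"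
      by (simp add: v(2)[OF that] nodal_def)
    then show ?thesis by blast
  qed
  moreover have "v b = (if b = a then 1 else 0)" if b: "b \<in> mesh_vertices \<T>" for b
  proof -
    obtain K where K: "K \<in> \<T>" "b \<in> vertices K" using b mesh_vertices_eq by blast
    then have "b \<in> K" by (simp add: vertices_def extreme_point_of_def)
    then show ?thesis using v(2)[OF K(1)] nodal_vertex[OF m K] by simp
  qed
  ultimately show ?thesis using v(1) by (auto simp: fe_space_def)
qed

lemma hat_props:
  fixes \<T> :: "(real^'n) set set"
  assumes m: "simplicial_mesh \<Omega> \<T>"
  shows hat_fe: "hat \<T> a \<in> fe_space \<T>"
    and hat_vertex: "b \<in> mesh_vertices \<T> \<Longrightarrow> hat \<T> a b = (if b = a then 1 else 0)"
  using someI_ex[OF hat_exists[OF m, of a]] unfolding hat_def[symmetric] by auto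

text \<open>
  Although \<open>hat\<close> is an arbitrary choice, its values at the vertices of an element determine it there.
\<close>

lemma hat_on_element:
  fixes \<T> :: "(real^'n) set set"
  assumes m: "simplicial_mesh \<Omega> \<T>" and K: "K \<in> \<T>" "x \<in> K"
  shows "hat \<T> a x = nodal K a x"
proof -
  obtain g c where "\<And>x. x \<in> K \<Longrightarrow> hat \<T> a x = g \<bullet> x + c"
    using hat_fe[OF m, of a] K(1) unfolding fe_space_def by blast
  then have "hat \<T> a x = (\<Sum>b\<in>vertices K. bary (vertices K) b x * hat \<T> a b)"
    by (rule affine_on_element[OF m K])
  also have "\<dots> = (\<Sum>b\<in>vertices K. if b = a then bary (vertices K) b x else 0)"
  proof (rule sum.cong[OF refl])
    fix b assume "b \<in> vertices K"
    then have "b \<in> mesh_vertices \<T>" using K(1) mesh_vertices_eq by blast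
    then show "bary (vertices K) b x * hat \<T> a b = (if b = a then bary (vertices K) b x else 0)"
      using hat_vertex[OF m] by simp
  qed
  also have "\<dots> = nodal K a x"
    using full_simplex_finite[OF mesh_element(1)[OF m K(1)]] by (simp add: nodal_def)
  finally show ?thesis .
qed

definition nodal_grad :: "'a::euclidean_space set \<Rightarrow> 'a \<Rightarrow> 'a" where
  "nodal_grad K a = (if a \<in> vertices K then bary_grad (vertices K) a else 0)"

lemma nodal_diff: "nodal K a x - nodal K a y = nodal_grad K a \<bullet> (x - y)"
  by (simp add: nodal_def nodal_grad_def bary_diff)

lemma grad_hat:
  fixes \<T> :: "(real^'n) set set"
  assumes m: "simplicial_mesh \<Omega> \<T>" and K: "K \<in> \<T>" "x \<in> interior K"
  shows "grad (hat \<T> a) x = nodal_grad K a"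
proof -
  let ?g = "nodal_grad K a"
  have "nodal K a y = nodal K a x + (y - x) \<bullet> ?g" for y
    using nodal_diff[of K a y x] by (simp add: inner_commute)
  then have nod: "nodal K a = (\<lambda>y. nodal K a x + (y - x) \<bullet> ?g)" by blast
  have "((\<lambda>y. nodal K a x + (y - x) \<bullet> ?g) has_derivative (\<lambda>h. h \<bullet> ?g)) (at x)"
    by (auto intro!: derivative_eq_intros)
  then have "(nodal K a has_derivative (\<lambda>h. h \<bullet> ?g)) (at x)"
    using nod by simp
  then have d: "(hat \<T> a has_derivative (\<lambda>h. h \<bullet> ?g)) (at x)"
    by (rule has_derivative_transform_within_open[OF _ open_interior K(2)])
      (use hat_on_element[OF m K(1)] interior_subset in force)
  show ?thesis
    unfolding grad_def gderiv_def
  proof (rule the_equality)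
    fix g assume "(hat \<T> a has_derivative (\<lambda>h. h \<bullet> g)) (at x)"
    then have "(\<lambda>h. h \<bullet> g) = (\<lambda>h. h \<bullet> ?g)"
      using d by (rule has_derivative_unique)
    then have "(g - ?g) \<bullet> (g - ?g) = 0"
      by (metis inner_diff_right right_minus_eq)
    then show "g = ?g" by simp
  qed (rule d)
qed

section \<open>Entries of the finite element matrices as sums over elements\<close>

lemma polyhedral_domain_imp:
  assumes "polyhedral_domain \<Omega>"
  shows "open \<Omega>" "connected \<Omega>"
  using assms unfolding polyhedral_domain_def by blast+

lemma negligible_frontier_polyhedral_domain:
  fixes \<Omega> :: "(real^'n) set"
  assumes "polyhedral_domain \<Omega>"
  shows "negligible (frontier \<Omega>)"
proof -
  obtain \<P> where P: "finite \<P>" "\<And>F. F \<in> \<P> \<Longrightarrow> polytope F \<and> aff_dim F = int CARD('n) - 1" "frontier \<Omega> = \<Union>\<P>"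
    using assms unfolding polyhedral_domain_def by blast
  have "negligible F" if "F \<in> \<P>" for F
  proof -
    have "interior F = {}"
      using P(2)[OF that] aff_dim_nonempty_interior[of F] by auto
    then show ?thesis
      using P(2)[OF that] negligible_convex_interior polytope_imp_convex by blast
  qed
  then show ?thesis using P(1,3) by auto
qed

text \<open>
  Elements cover the closure of the domain, gradients exist in the interior of elements, and the
  diffusion matrix is controlled only in the domain.  The pieces \<open>\<Omega> \<inter> interior K\<close> satisfy all three
  needs at once and lose only a null set.
\<close>

definition piece :: "'a::euclidean_space set \<Rightarrow> 'a set \<Rightarrow> 'a set" where
  "piece \<Omega> K = \<Omega> \<inter> interior K"

definition element_mass :: "(real^'n) set \<Rightarrow> real^'n \<Rightarrow> real^'n \<Rightarrow> real" where
  "element_mass K a b = (if a \<in> vertices K \<and> b \<in> vertices K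
    then (if a = b then 2 else 1) * (measure lborel K / ((real CARD('n) + 1) * (real CARD('n) + 2))) else 0)"

context
  fixes \<Omega> :: "(real^'n) set" and \<T> :: "(real^'n) set set"
  assumes dom: "polyhedral_domain \<Omega>" and mesh: "simplicial_mesh \<Omega> \<T>"
begin

lemma piece_open: "open (piece \<Omega> K)"
  unfolding piece_def using polyhedral_domain_imp(1)[OF dom] by (intro open_Int open_interior)

lemma piece_subset: "piece \<Omega> K \<subseteq> K" "piece \<Omega> K \<subseteq> interior K" "piece \<Omega> K \<subseteq> \<Omega>"
  using interior_subset by (auto simp: piece_def)

lemma piece_sets: "piece \<Omega> K \<in> sets borel" "piece \<Omega> K \<in> sets lebesgue"
  using piece_open by auto

lemma negligible_element_minus_piece:
  assumes "K \<in> \<T>"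
  shows "negligible (K - piece \<Omega> K)"
proof (rule negligible_subset)
  show "negligible (frontier K \<union> frontier \<Omega>)"
    using negligible_frontier_polyhedral_domain[OF dom] negligible_convex_frontier[OF mesh_compact(2)[OF mesh assms]]
    by simp
  show "K - piece \<Omega> K \<subseteq> frontier K \<union> frontier \<Omega>"
  proof
    fix x assume x: "x \<in> K - piece \<Omega> K"
    then have "x \<in> closure \<Omega>" using mesh_Union[OF mesh] assms by blast
    moreover have "x \<in> closure K" using x closure_subset by blast
    moreover have "interior \<Omega> = \<Omega>" using polyhedral_domain_imp(1)[OF dom] by (rule interior_open)
    ultimately show "x \<in> frontier K \<union> frontier \<Omega>"
      using x by (auto simp: frontier_def piece_def)
  qed
qed

lemma negligible_domain_minus_pieces: "negligible (\<Omega> - (\<Union>K\<in>\<T>. piece \<Omega> K))"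
proof (rule negligible_subset)
  show "negligible (\<Union>K\<in>\<T>. K - piece \<Omega> K)"
    using mesh_finite[OF mesh] negligible_element_minus_piece by blast
  show "\<Omega> - (\<Union>K\<in>\<T>. piece \<Omega> K) \<subseteq> (\<Union>K\<in>\<T>. K - piece \<Omega> K)"
  proof
    fix x assume x: "x \<in> \<Omega> - (\<Union>K\<in>\<T>. piece \<Omega> K)"
    then have "x \<in> \<Union>\<T>" using mesh_Union[OF mesh] closure_subset[of \<Omega>] by auto
    then show "x \<in> (\<Union>K\<in>\<T>. K - piece \<Omega> K)" using x by auto
  qed
qed

text \<open>
  If the interiors of two elements meet, then their intersection is a face of both that meets both
  interiors, hence is all of both.
\<close>

lemma pieces_disjoint:
  assumes "K \<in> \<T>" "L \<in> \<T>" "x \<in> piece \<Omega> K" "x \<in> piece \<Omega> L"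
  shows "K = L"
proof -
  have x: "x \<in> interior K" "x \<in> interior L" "x \<in> K \<inter> L"
    using assms piece_subset by blast+
  have "K \<inter> L = K'" if "K' = K \<or> K' = L" for K'
  proof (rule ccontr)
    assume "K \<inter> L \<noteq> K'"
    moreover have "K \<inter> L face_of K'"
      using that mesh_conforming[OF mesh assms(1,2)] mesh_conforming[OF mesh assms(2,1)]
      by (auto simp: Int_commute)
    ultimately have "K \<inter> L \<inter> interior K' = {}"
      by (rule face_of_disjoint_interior[rotated])
    then show False using that x by blast
  qed
  then show ?thesis by metis
qed

lemma integral_domain_eq_sum_pieces:
  fixes f :: "real^'n \<Rightarrow> real"
  assumes f: "\<And>K. K \<in> \<T> \<Longrightarrow> set_integrable lebesgue (piece \<Omega> K) f"
  shows "set_integrable lebesgue \<Omega> f"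
    and "(LINT x:\<Omega>|lebesgue. f x) = (\<Sum>K\<in>\<T>. LINT x:piece \<Omega> K|lebesgue. f x)"
proof -
  let ?U = "\<Union>K\<in>\<T>. piece \<Omega> K"
  have "set_integrable lebesgue ?U f"
    using mesh_finite[OF mesh] f piece_sets by (intro set_integrable_UN) auto
  moreover have neg: "negligible {x \<in> \<Omega> - ?U. f x \<noteq> 0}" "negligible {x \<in> ?U - \<Omega>. f x \<noteq> 0}"
    using piece_subset(3) by (auto intro: negligible_subset[OF negligible_domain_minus_pieces]
      negligible_subset[OF negligible_empty])
  ultimately show *: "set_integrable lebesgue \<Omega> f"
    using absolutely_integrable_spike_set_eq[OF neg] by simp
  from * have "(LINT x:\<Omega>|lebesgue. f x) = integral \<Omega> f"
    by (rule set_lebesgue_integral_eq_integral)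
  also have "\<dots> = integral ?U f"
    using neg by (rule integral_spike_set)
  also have "\<dots> = (LINT x:?U|lebesgue. f x)"
    using \<open>set_integrable lebesgue ?U f\<close> by (simp add: set_lebesgue_integral_eq_integral)
  also have "\<dots> = (\<Sum>K\<in>\<T>. LINT x:piece \<Omega> K|lebesgue. f x)"
  proof (rule set_integral_finite_UN_AE[OF mesh_finite[OF mesh] _ piece_sets(2) f])
    show "AE x in lebesgue. x \<in> piece \<Omega> K \<and> x \<in> piece \<Omega> L \<longrightarrow> K = L" if "K \<in> \<T>" "L \<in> \<T>" for K L
      using pieces_disjoint[OF that] by (intro AE_I2) blast
  qed
  finally show "(LINT x:\<Omega>|lebesgue. f x) = (\<Sum>K\<in>\<T>. LINT x:piece \<Omega> K|lebesgue. f x)" .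
qed

lemma integral_element_eq_piece:
  fixes f :: "real^'n \<Rightarrow> 'b::euclidean_space"
  assumes K: "K \<in> \<T>" and f: "set_integrable lebesgue (piece \<Omega> K) f"
  shows "(LINT x:K|lebesgue. f x) = (LINT x:piece \<Omega> K|lebesgue. f x)"
proof -
  have neg: "negligible {x \<in> K - piece \<Omega> K. f x \<noteq> 0}" "negligible {x \<in> piece \<Omega> K - K. f x \<noteq> 0}"
    using piece_subset(1) by (auto intro: negligible_subset[OF negligible_element_minus_piece[OF K]]
      negligible_subset[OF negligible_empty])
  have "set_integrable lebesgue K f"
    using absolutely_integrable_spike_set_eq[OF neg] f by simp
  then show ?thesis
    using f integral_spike_set[OF neg] by (simp add: set_lebesgue_integral_eq_integral)
qed

lemma measure_piece:
  assumes K: "K \<in> \<T>"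
  shows "measure lebesgue (piece \<Omega> K) = measure lborel K" "measure lborel K > 0"
    "emeasure lebesgue (piece \<Omega> K) \<noteq> \<infinity>"
proof -
  have "measure lebesgue (piece \<Omega> K) = measure lebesgue K"
  proof (rule measure_negligible_symdiff)
    have "K - piece \<Omega> K \<union> (piece \<Omega> K - K) = K - piece \<Omega> K" using piece_subset(1) by blast
    then show "negligible (K - piece \<Omega> K \<union> (piece \<Omega> K - K))"
      using negligible_element_minus_piece[OF K] by simp
  qed (use mesh_compact[OF mesh K] lmeasurable_compact in blast)
  then show "measure lebesgue (piece \<Omega> K) = measure lborel K"
    using mesh_compact[OF mesh K] by (simp add: borel_compact)
  note V = mesh_element[OF mesh K]
  have "interior (convex hull vertices K) \<noteq> {}"
    using V(1) interior_convex_hull_eq_empty[of "vertices K"] by (auto simp: full_simplex_def)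
  then have "\<not> negligible K"
    using V(2) negligible_convex_interior[OF mesh_compact(2)[OF mesh K]] by simp
  then have "measure lebesgue K \<noteq> 0"
    using negligible_iff_measure lmeasurable_compact[OF mesh_compact(1)[OF mesh K]] by blast
  then show "measure lborel K > 0"
    using mesh_compact[OF mesh K] by (simp add: borel_compact zero_less_measure_iff)
  have "emeasure lborel (piece \<Omega> K) \<le> emeasure lborel K"
    using piece_subset(1) mesh_compact(1)[OF mesh K] by (intro emeasure_mono) (auto simp: borel_compact)
  also have "\<dots> < \<infinity>" using emeasure_compact_finite[OF mesh_compact(1)[OF mesh K]] .
  finally show "emeasure lebesgue (piece \<Omega> K) \<noteq> \<infinity>" using piece_sets by simp
qed

lemma piece_mass:
  assumes K: "K \<in> \<T>"
  shows "set_integrable lebesgue (piece \<Omega> K) (\<lambda>x. hat \<T> a x * hat \<T> b x)"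
    and "(LINT x:piece \<Omega> K|lebesgue. hat \<T> a x * hat \<T> b x) = element_mass K a b"
proof -
  let ?f = "\<lambda>x. nodal K a x * nodal K b x"
  have hat: "hat \<T> a x * hat \<T> b x = ?f x" if "x \<in> piece \<Omega> K" for x
    using hat_on_element[OF mesh K subsetD[OF piece_subset(1) that]] by simp
  have "continuous_on K ?f"
    by (intro continuous_intros continuous_nodal)
  then have int: "integrable lborel (\<lambda>x. indicator K x *\<^sub>R ?f x)"
    by (rule borel_integrable_compact[OF mesh_compact(1)[OF mesh K]])
  then have "set_integrable lebesgue K ?f"
    unfolding set_integrable_def by (subst integrable_completion) auto
  then have fint: "set_integrable lebesgue (piece \<Omega> K) ?f"
    using piece_sets(2) piece_subset(1) by (rule set_integrable_subset)
  then show "set_integrable lebesgue (piece \<Omega> K) (\<lambda>x. hat \<T> a x * hat \<T> b x)"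
    by (rule set_integrable_cong[THEN iffD2, rotated -1]) (auto simp: hat)
  have "(LINT x:piece \<Omega> K|lebesgue. hat \<T> a x * hat \<T> b x) = (LINT x:piece \<Omega> K|lebesgue. ?f x)"
    using hat by (intro set_lebesgue_integral_cong piece_sets) auto
  also have "\<dots> = (LINT x:K|lebesgue. ?f x)"
    using integral_element_eq_piece[OF K fint] by simp
  also have "\<dots> = (LINT x:K|lborel. ?f x)"
    unfolding set_lebesgue_integral_def using int by (intro integral_completion) auto
  also have "\<dots> = element_mass K a b"
  proof (cases "a \<in> vertices K \<and> b \<in> vertices K")
    case True
    then show ?thesis
      using bary_moments[OF mesh_element(1)[OF mesh K], of a b] mesh_element(2)[OF mesh K]
      by (simp add: nodal_def element_mass_def algebra_simps)
  next
    case False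
    then show ?thesis by (auto simp: nodal_def element_mass_def)
  qed
  finally show "(LINT x:piece \<Omega> K|lebesgue. hat \<T> a x * hat \<T> b x) = element_mass K a b" .
qed

lemma mass_entry:
  shows "set_integrable lebesgue \<Omega> (\<lambda>x. hat \<T> a x * hat \<T> b x)"
    and "(LINT x:\<Omega>|lebesgue. hat \<T> a x * hat \<T> b x) = (\<Sum>K\<in>\<T>. element_mass K a b)"
  using integral_domain_eq_sum_pieces[of "\<lambda>x. hat \<T> a x * hat \<T> b x"] piece_mass by simp_all

context
  fixes D :: "real^'n \<Rightarrow> real^'n^'n"
  assumes diff: "diffusion_matrix \<Omega> D"
begin

lemma piece_diffusion_form:
  assumes K: "K \<in> \<T>"
  shows "set_integrable lebesgue (piece \<Omega> K) (\<lambda>x. g \<bullet> (D x *v h))"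
    and "(LINT x:piece \<Omega> K|lebesgue. g \<bullet> (D x *v h)) = g \<bullet> ((LINT x:K|lebesgue. D x) *v h)"
proof -
  have "linear (\<lambda>X :: real^'n^'n. g \<bullet> (X *v h))"
    by (rule linearI) (simp_all add: matrix_vector_mult_add_rdistrib inner_add_right
      scaleR_matrix_vector_assoc[symmetric])
  then have lin: "bounded_linear (\<lambda>X :: real^'n^'n. g \<bullet> (X *v h))"
    by (rule linear_conv_bounded_linear[THEN iffD1])
  have zero: "indicator S x *\<^sub>R (g \<bullet> (D x *v h)) = g \<bullet> ((indicator S x *\<^sub>R D x) *v h)" for S x
    by (simp add: scaleR_matrix_vector_assoc[symmetric])
  have "set_integrable lebesgue \<Omega> D"
    using diff unfolding diffusion_matrix_def by blast
  then have Dint: "set_integrable lebesgue (piece \<Omega> K) D"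
    using piece_sets(2) piece_subset(3) by (rule set_integrable_subset)
  show "set_integrable lebesgue (piece \<Omega> K) (\<lambda>x. g \<bullet> (D x *v h))"
    using integrable_bounded_linear[OF lin Dint[unfolded set_integrable_def]]
    unfolding set_integrable_def zero .
  have "(LINT x:piece \<Omega> K|lebesgue. g \<bullet> (D x *v h)) = g \<bullet> ((LINT x:piece \<Omega> K|lebesgue. D x) *v h)"
    using integral_bounded_linear[OF lin Dint[unfolded set_integrable_def]]
    unfolding set_lebesgue_integral_def zero .
  then show "(LINT x:piece \<Omega> K|lebesgue. g \<bullet> (D x *v h)) = g \<bullet> ((LINT x:K|lebesgue. D x) *v h)"
    using integral_element_eq_piece[OF K Dint] by simp
qed

lemma element_diffusion_symmetric:
  assumes K: "K \<in> \<T>"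
  shows "g \<bullet> ((LINT x:K|lebesgue. D x) *v h) = h \<bullet> ((LINT x:K|lebesgue. D x) *v g)"
proof -
  have "g \<bullet> (D x *v h) = h \<bullet> (D x *v g)" if "x \<in> piece \<Omega> K" for x
  proof -
    have "Finite_Cartesian_Product.transpose (D x) = D x"
      using diff that piece_subset(3) unfolding diffusion_matrix_def by blast
    then have "g \<bullet> (D x *v h) = (D x *v g) \<bullet> h"
      by (metis dot_lmul_matrix transpose_matrix_vector)
    then show ?thesis by (simp add: inner_commute)
  qed
  then have "(LINT x:piece \<Omega> K|lebesgue. g \<bullet> (D x *v h)) = (LINT x:piece \<Omega> K|lebesgue. h \<bullet> (D x *v g))"
    by (intro set_lebesgue_integral_cong piece_sets) auto
  then show ?thesis by (simp add: piece_diffusion_form(2)[OF K])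
qed

lemma element_diffusion_positive:
  assumes K: "K \<in> \<T>" and "g \<noteq> 0"
  shows "0 < g \<bullet> ((LINT x:K|lebesgue. D x) *v g)"
proof -
  obtain \<alpha> where \<alpha>: "\<alpha> > 0" "\<And>x. x \<in> \<Omega> \<Longrightarrow> \<alpha> * (norm g)\<^sup>2 \<le> g \<bullet> (D x *v g)"
    using diff unfolding diffusion_matrix_def by blast
  have "0 < \<alpha> * (norm g)\<^sup>2 * measure lborel K"
    using \<alpha>(1) assms(2) measure_piece(2)[OF K] by simp
  also have "\<dots> = (LINT x:piece \<Omega> K|lebesgue. \<alpha> * (norm g)\<^sup>2)"
    using measure_piece(1,3)[OF K] piece_sets by (subst set_integral_const) (auto simp: mult.commute)
  also have "\<dots> \<le> (LINT x:piece \<Omega> K|lebesgue. g \<bullet> (D x *v g))"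
  proof (rule set_integral_mono[OF _ piece_diffusion_form(1)[OF K]])
    show "set_integrable lebesgue (piece \<Omega> K) (\<lambda>_. \<alpha> * (norm g)\<^sup>2)"
      unfolding set_integrable_def using measure_piece(3)[OF K] piece_sets
      by (intro integrable_scaleR_left integrable_real_indicator) (auto simp: less_top[symmetric])
  qed (use \<alpha>(2) piece_subset(3) in blast)
  finally show ?thesis by (simp add: piece_diffusion_form(2)[OF K])
qed

lemma stiffness_entry:
  "(LINT x:\<Omega>|lebesgue. grad (hat \<T> a) x \<bullet> (D x *v grad (hat \<T> b) x))
    = (\<Sum>K\<in>\<T>. nodal_grad K a \<bullet> ((LINT x:K|lebesgue. D x) *v nodal_grad K b))"
proof -
  let ?f = "\<lambda>x. grad (hat \<T> a) x \<bullet> (D x *v grad (hat \<T> b) x)"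
  have eq: "?f x = nodal_grad K a \<bullet> (D x *v nodal_grad K b)" if "K \<in> \<T>" "x \<in> piece \<Omega> K" for K x
    using grad_hat[OF mesh that(1) subsetD[OF piece_subset(2) that(2)]] by simp
  have "set_integrable lebesgue (piece \<Omega> K) ?f" if "K \<in> \<T>" for K
    using piece_diffusion_form(1)[OF that]
    by (rule set_integrable_cong[THEN iffD2, rotated -1]) (auto simp: eq[OF that])
  then have "(LINT x:\<Omega>|lebesgue. ?f x) = (\<Sum>K\<in>\<T>. LINT x:piece \<Omega> K|lebesgue. ?f x)"
    by (rule integral_domain_eq_sum_pieces)
  also have "\<dots> = (\<Sum>K\<in>\<T>. nodal_grad K a \<bullet> ((LINT x:K|lebesgue. D x) *v nodal_grad K b))"
  proof (rule sum.cong[OF refl])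
    fix K assume K: "K \<in> \<T>"
    have "(LINT x:piece \<Omega> K|lebesgue. ?f x) = (LINT x:piece \<Omega> K|lebesgue. nodal_grad K a \<bullet> (D x *v nodal_grad K b))"
      using eq[OF K] by (intro set_lebesgue_integral_cong piece_sets) auto
    then show "(LINT x:piece \<Omega> K|lebesgue. ?f x) = nodal_grad K a \<bullet> ((LINT x:K|lebesgue. D x) *v nodal_grad K b)"
      by (simp add: piece_diffusion_form(2)[OF K])
  qed
  finally show ?thesis .
qed

end
end

section \<open>Element inequalities and assembly\<close>

lemma hausdorff_measure_empty: "hausdorff_measure s {} = 0"
proof -
  have "(INF U\<in>{U :: nat \<Rightarrow> 'a set. {} \<subseteq> (\<Union>i. U i) \<and> (\<forall>i. bounded (U i) \<and> diameter (U i) \<le> \<delta>)}.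
      \<Sum>i. if U i = {} then 0 else ennreal (diameter (U i) ^ s)) \<le> 0" if "\<delta> > 0" for \<delta>
    using that by (intro INF_lower2[of "\<lambda>_. {}"]) auto
  then show ?thesis unfolding hausdorff_measure_def by (simp add: SUP_eq_iff)
qed

text \<open>
  Positive measure makes the Dirichlet part nonempty, so it contains a face of an element and the
  vertices of that face.
\<close>

lemma dirichlet_vertex_exists:
  fixes \<T> :: "(real^'n) set set"
  assumes m: "simplicial_mesh \<Omega> \<T>" and pos: "hausdorff_measure s \<Gamma>\<^sub>D > 0"
    and faces: "\<exists>\<F>\<subseteq>mesh_faces \<T>. \<Gamma>\<^sub>D = \<Union>\<F>"
  obtains b where "b \<in> mesh_vertices \<T>" "b \<in> \<Gamma>\<^sub>D"
proof -
  have "\<Gamma>\<^sub>D \<noteq> {}"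
  proof
    assume "\<Gamma>\<^sub>D = {}"
    then show False using pos by (simp add: hausdorff_measure_empty)
  qed
  then obtain F K where F: "F \<subseteq> \<Gamma>\<^sub>D" "K \<in> \<T>" "F facet_of K"
    using faces unfolding mesh_faces_def by blast
  have face: "F face_of K" "F \<noteq> {}" using F(3) by (auto simp: facet_of_def)
  have "compact F" "convex F"
    using face_of_imp_compact[OF mesh_compact(2,1)[OF m F(2)] face(1)] face_of_imp_convex[OF face(1)]
      mesh_compact(2)[OF m F(2)] by auto
  then obtain b where "b extreme_point_of F"
    using extreme_point_exists_convex face(2) by blast
  then have "b extreme_point_of K" "b \<in> F"
    using extreme_point_of_face[OF face(1)] by auto
  then show thesis using that[of b] F by (auto simp: mesh_vertices_def)
qed

text \<open>
  Each mixed term is at most the mean of the two squares, as the form is nonnegative at \<open>w a - w b\<close>, and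
  every square occurs in \<open>card S\<close> pairs.
\<close>

lemma positive_form_le_card_diagonal:
  fixes E :: "real^'n^'n" and w :: "'a \<Rightarrow> real^'n"
  assumes sym: "\<And>g h. g \<bullet> (E *v h) = h \<bullet> (E *v g)" and pos: "\<And>g. 0 \<le> g \<bullet> (E *v g)"
  shows "(\<Sum>a\<in>S. \<Sum>b\<in>S. w a \<bullet> (E *v w b)) \<le> card S * (\<Sum>a\<in>S. w a \<bullet> (E *v w a))"
proof -
  have "w a \<bullet> (E *v w b) \<le> (w a \<bullet> (E *v w a) + w b \<bullet> (E *v w b)) / 2" for a b
    using pos[of "w a - w b"] sym[of "w a" "w b"] by (simp add: algebra_simps)
  then have "(\<Sum>a\<in>S. \<Sum>b\<in>S. w a \<bullet> (E *v w b))
      \<le> (\<Sum>a\<in>S. \<Sum>b\<in>S. (w a \<bullet> (E *v w a) + w b \<bullet> (E *v w b)) / 2)"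
    by (intro sum_mono)
  also have "\<dots> = card S * (\<Sum>a\<in>S. w a \<bullet> (E *v w a))"
    by (simp add: add_divide_distrib sum.distrib sum_distrib_left sum_divide_distrib[symmetric])
  finally show ?thesis .
qed

text \<open>
  This is where nonobtuse meshes gain a constant independent of the dimension.  With nonpositive
  off-diagonal entries, \<open>U\<^sub>aU\<^sub>be\<^sub>a\<^sub>b \<le> - (U\<^sub>a\<^sup>2 + U\<^sub>b\<^sup>2) e\<^sub>a\<^sub>b / 2\<close> for \<open>a \<noteq> b\<close>, while for \<open>a = b\<close> the two
  sides differ by \<open>2 U\<^sub>a\<^sup>2e\<^sub>a\<^sub>a\<close>.  Summing over all pairs, the right-hand sides cancel by the vanishing row
  sums and only these differences remain.
\<close>

lemma zero_row_sum_le_twice_diagonal: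
  fixes e :: "'a \<Rightarrow> 'a \<Rightarrow> real"
  assumes fin: "finite S" and sym: "\<And>a b. a \<in> S \<Longrightarrow> b \<in> S \<Longrightarrow> e a b = e b a"
    and off: "\<And>a b. a \<in> S \<Longrightarrow> b \<in> S \<Longrightarrow> a \<noteq> b \<Longrightarrow> e a b \<le> 0"
    and row: "\<And>a. a \<in> S \<Longrightarrow> (\<Sum>b\<in>S. e a b) = 0"
  shows "(\<Sum>a\<in>S. \<Sum>b\<in>S. U a * U b * e a b) \<le> 2 * (\<Sum>a\<in>S. (U a)\<^sup>2 * e a a)"
proof -
  have "U a * U b * e a b \<le> - ((U a)\<^sup>2 * e a b + (U b)\<^sup>2 * e b a) / 2 + (if a = b then 2 * (U a)\<^sup>2 * e a a else 0)"
    if "a \<in> S" "b \<in> S" for a b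
  proof (cases "a = b")
    case True
    then show ?thesis by (simp add: power2_eq_square)
  next
    case False
    have "0 \<le> (U a + U b)\<^sup>2 * - e a b"
      using off[OF that False] by (intro mult_nonneg_nonneg) auto
    then show ?thesis
      using False by (simp add: sym[OF that(2,1)] power2_eq_square algebra_simps)
  qed
  then have "(\<Sum>a\<in>S. \<Sum>b\<in>S. U a * U b * e a b)
      \<le> (\<Sum>a\<in>S. \<Sum>b\<in>S. - ((U a)\<^sup>2 * e a b + (U b)\<^sup>2 * e b a) / 2 + (if a = b then 2 * (U a)\<^sup>2 * e a a else 0))"
    by (intro sum_mono) auto
  also have "\<dots> = - ((\<Sum>a\<in>S. \<Sum>b\<in>S. (U a)\<^sup>2 * e a b) + (\<Sum>a\<in>S. \<Sum>b\<in>S. (U b)\<^sup>2 * e b a)) / 2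
      + 2 * (\<Sum>a\<in>S. (U a)\<^sup>2 * e a a)"
    using fin by (simp add: sum.distrib sum_negf sum_divide_distrib[symmetric] sum_distrib_left mult.assoc sum_subtractf)
  also have "(\<Sum>a\<in>S. \<Sum>b\<in>S. (U a)\<^sup>2 * e a b) = 0"
    by (simp add: sum_distrib_left[symmetric] row)
  also have "(\<Sum>a\<in>S. \<Sum>b\<in>S. (U b)\<^sup>2 * e b a) = 0"
    by (subst sum.swap) (simp add: sum_distrib_left[symmetric] row)
  finally show ?thesis by simp
qed

text \<open>
  The matrix is \<open>\<kappa>(I + J)\<close> with the all-ones matrix \<open>J\<close>: dropping the square \<open>\<kappa>(\<Sum>U\<^sub>a)\<^sup>2\<close> leaves \<open>\<kappa>I\<close>, which is half
  of the diagonal.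
\<close>

lemma half_diagonal_le_mass_form:
  fixes \<kappa> :: real
  assumes "finite S" "\<kappa> \<ge> 0"
  shows "1 / 2 * (\<Sum>a\<in>S. (U a)\<^sup>2 * (2 * \<kappa>)) \<le> (\<Sum>a\<in>S. \<Sum>b\<in>S. U a * U b * ((if a = b then 2 else 1) * \<kappa>))"
proof -
  have "(\<Sum>a\<in>S. \<Sum>b\<in>S. U a * U b * ((if a = b then 2 else 1) * \<kappa>))
      = (\<Sum>a\<in>S. \<Sum>b\<in>S. U a * U b * \<kappa> + (if a = b then (U a)\<^sup>2 * \<kappa> else 0))"
    by (intro sum.cong refl) (auto simp: power2_eq_square)
  also have "\<dots> = (\<Sum>a\<in>S. U a)\<^sup>2 * \<kappa> + (\<Sum>a\<in>S. (U a)\<^sup>2 * \<kappa>)"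
  proof -
    have "(\<Sum>a\<in>S. \<Sum>b\<in>S. U a * U b * \<kappa>) = (\<Sum>a\<in>S. U a)\<^sup>2 * \<kappa>"
      unfolding power2_eq_square sum_product by (simp add: sum_distrib_right)
    then show ?thesis using assms(1) by (simp add: sum.distrib)
  qed
  finally show ?thesis
    using assms(2) by (simp add: sum_distrib_left mult_ac)
qed

text \<open>
  Extending the coefficients by zero to all vertices, those on the Dirichlet part included, turns the
  form of an assembled matrix into a sum of complete element forms.  This is what makes the element
  inequalities applicable, since the row sums vanish only over all vertices of an element.
\<close>

lemma bilin_form_assembled:
  fixes e :: "'k \<Rightarrow> 'v \<Rightarrow> 'v \<Rightarrow> real"
  assumes p: "inj_on p {..<n}" and fin: "\<And>K. K \<in> \<T> \<Longrightarrow> finite (V K)"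
    and X: "\<And>i j. i < n \<Longrightarrow> j < n \<Longrightarrow> X $$ (i, j) = (\<Sum>K\<in>\<T>. e K (p i) (p j))"
    and e: "\<And>K a b. K \<in> \<T> \<Longrightarrow> a \<notin> V K \<or> b \<notin> V K \<Longrightarrow> e K a b = 0"
    and U: "\<And>i. i < n \<Longrightarrow> U (p i) = u i" "\<And>a. a \<notin> p ` {..<n} \<Longrightarrow> U a = 0"
  shows "bilin_form n X u u = (\<Sum>K\<in>\<T>. \<Sum>a\<in>V K. \<Sum>b\<in>V K. U a * U b * e K a b)"
    and "(\<Sum>i<n. X $$ (i, i) * (u i)\<^sup>2) = (\<Sum>K\<in>\<T>. \<Sum>a\<in>V K. (U a)\<^sup>2 * e K a a)"
proof -
  have re: "(\<Sum>i<n. h (p i)) = (\<Sum>a\<in>V K. h a)"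
    if K: "K \<in> \<T>" and h: "\<And>a. a \<notin> V K \<Longrightarrow> h a = 0" "\<And>a. U a = 0 \<Longrightarrow> h a = 0" for K and h :: "'v \<Rightarrow> real"
  proof -
    have "(\<Sum>i<n. h (p i)) = (\<Sum>a\<in>p ` {..<n}. h a)"
      using p by (simp add: sum.reindex)
    also have "\<dots> = (\<Sum>a\<in>p ` {..<n} \<union> V K. h a)"
      using fin[OF K] U(2) h(2) by (intro sum.mono_neutral_left) auto
    also have "\<dots> = (\<Sum>a\<in>V K. h a)"
      using fin[OF K] h(1) by (intro sum.mono_neutral_right) auto
    finally show ?thesis .
  qed
  have "bilin_form n X u u = (\<Sum>i<n. \<Sum>j<n. \<Sum>K\<in>\<T>. U (p i) * U (p j) * e K (p i) (p j))"
    unfolding bilin_form_def mat_apply_def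
    by (simp add: X U(1) sum_distrib_left sum_distrib_right mult_ac)
  also have "\<dots> = (\<Sum>i<n. \<Sum>K\<in>\<T>. \<Sum>j<n. U (p i) * U (p j) * e K (p i) (p j))"
    by (intro sum.cong refl sum.swap)
  also have "\<dots> = (\<Sum>K\<in>\<T>. \<Sum>i<n. \<Sum>j<n. U (p i) * U (p j) * e K (p i) (p j))"
    by (rule sum.swap)
  also have "\<dots> = (\<Sum>K\<in>\<T>. \<Sum>a\<in>V K. \<Sum>b\<in>V K. U a * U b * e K a b)"
  proof (rule sum.cong[OF refl])
    fix K assume K: "K \<in> \<T>"
    have "(\<Sum>i<n. \<Sum>j<n. U (p i) * U (p j) * e K (p i) (p j))
        = (\<Sum>i<n. \<Sum>b\<in>V K. U (p i) * U b * e K (p i) b)"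
      using e[OF K] by (intro sum.cong refl re[OF K]) auto
    also have "\<dots> = (\<Sum>a\<in>V K. \<Sum>b\<in>V K. U a * U b * e K a b)"
      using e[OF K] by (intro re[OF K]) auto
    finally show "(\<Sum>i<n. \<Sum>j<n. U (p i) * U (p j) * e K (p i) (p j))
        = (\<Sum>a\<in>V K. \<Sum>b\<in>V K. U a * U b * e K a b)" .
  qed
  finally show "bilin_form n X u u = (\<Sum>K\<in>\<T>. \<Sum>a\<in>V K. \<Sum>b\<in>V K. U a * U b * e K a b)" .
  have "(\<Sum>i<n. X $$ (i, i) * (u i)\<^sup>2) = (\<Sum>i<n. \<Sum>K\<in>\<T>. (U (p i))\<^sup>2 * e K (p i) (p i))"
    by (simp add: X U(1) sum_distrib_left sum_distrib_right mult_ac)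
  also have "\<dots> = (\<Sum>K\<in>\<T>. \<Sum>i<n. (U (p i))\<^sup>2 * e K (p i) (p i))"
    by (rule sum.swap)
  also have "\<dots> = (\<Sum>K\<in>\<T>. \<Sum>a\<in>V K. (U a)\<^sup>2 * e K a a)"
    using e by (intro sum.cong refl re) auto
  finally show "(\<Sum>i<n. X $$ (i, i) * (u i)\<^sup>2) = (\<Sum>K\<in>\<T>. \<Sum>a\<in>V K. (U a)\<^sup>2 * e K a a)" .
qed

lemma element_mass_bound:
  fixes \<T> :: "(real^'n) set set"
  assumes mesh: "simplicial_mesh \<Omega> \<T>" and K: "K \<in> \<T>"
  shows "1 / 2 * (\<Sum>a\<in>vertices K. (U a)\<^sup>2 * element_mass K a a)
    \<le> (\<Sum>a\<in>vertices K. \<Sum>b\<in>vertices K. U a * U b * element_mass K a b)"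
proof -
  define \<kappa> where "\<kappa> = measure lborel K / ((real CARD('n) + 1) * (real CARD('n) + 2))"
  have "element_mass K a b = (if a = b then 2 else 1) * \<kappa>" if "a \<in> vertices K" "b \<in> vertices K" for a b
    using that by (simp add: element_mass_def \<kappa>_def)
  then show ?thesis
    using half_diagonal_le_mass_form[OF full_simplex_finite[OF mesh_element(1)[OF mesh K]], of \<kappa> U]
    by (simp add: \<kappa>_def cong: sum.cong)
qed

text \<open>
  The gradients are constant on an element, so only the integral of the diffusion matrix enters; it is
  the mean diffusion up to the positive factor \<open>measure K\<close>, which does not affect signs.
\<close>

definition element_stiffness :: "(real^'n \<Rightarrow> real^'n^'n) \<Rightarrow> (real^'n) set \<Rightarrow> real^'n \<Rightarrow> real^'n \<Rightarrow> real" where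
  "element_stiffness D K a b = nodal_grad K a \<bullet> ((LINT x:K|lebesgue. D x) *v nodal_grad K b)"

context
  fixes \<Omega> :: "(real^'n) set" and \<T> :: "(real^'n) set set" and D :: "real^'n \<Rightarrow> real^'n^'n"
  assumes dom: "polyhedral_domain \<Omega>" and mesh: "simplicial_mesh \<Omega> \<T>" and diff: "diffusion_matrix \<Omega> D"
begin

lemma element_stiffness_bound:
  assumes K: "K \<in> \<T>"
  shows "(\<Sum>a\<in>vertices K. \<Sum>b\<in>vertices K. U a * U b * element_stiffness D K a b)
    \<le> (real CARD('n) + 1) * (\<Sum>a\<in>vertices K. (U a)\<^sup>2 * element_stiffness D K a a)"
proof -
  let ?E = "LINT x:K|lebesgue. D x" and ?w = "\<lambda>a. U a *\<^sub>R nodal_grad K a"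
  have "0 \<le> g \<bullet> (?E *v g)" for g
    using element_diffusion_positive[OF dom mesh diff K, of g] by (cases "g = 0") auto
  then have bound: "(\<Sum>a\<in>vertices K. \<Sum>b\<in>vertices K. ?w a \<bullet> (?E *v ?w b))
      \<le> card (vertices K) * (\<Sum>a\<in>vertices K. ?w a \<bullet> (?E *v ?w a))"
    by (intro positive_form_le_card_diagonal element_diffusion_symmetric[OF dom mesh diff K])
  have w: "?w a \<bullet> (?E *v ?w b) = U a * U b * element_stiffness D K a b" for a b
    by (simp add: element_stiffness_def matrix_vector_mult_scaleR mult_ac)
  have card: "card (vertices K) = CARD('n) + 1"
    using mesh_element(1)[OF mesh K] by (simp add: full_simplex_def)
  show ?thesis using bound unfolding w card power2_eq_square by (simp add: add.commute)
qed

lemma element_stiffness_bound_nonobtuse: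
  assumes K: "K \<in> \<T>" and non: "nonobtuse D \<T>"
  shows "(\<Sum>a\<in>vertices K. \<Sum>b\<in>vertices K. U a * U b * element_stiffness D K a b)
    \<le> 2 * (\<Sum>a\<in>vertices K. (U a)\<^sup>2 * element_stiffness D K a a)"
proof (rule zero_row_sum_le_twice_diagonal)
  let ?E = "LINT x:K|lebesgue. D x"
  note V = mesh_element(1)[OF mesh K]
  show "finite (vertices K)" by (rule full_simplex_finite[OF V])
  show "element_stiffness D K a b = element_stiffness D K b a" for a b
    unfolding element_stiffness_def by (rule element_diffusion_symmetric[OF dom mesh diff K])
  have "(\<Sum>b\<in>vertices K. nodal_grad K b) = 0"
    using sum_bary_grad[OF V] by (simp add: nodal_grad_def)
  then show "(\<Sum>b\<in>vertices K. element_stiffness D K a b) = 0" for a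
    by (simp add: element_stiffness_def inner_sum_right[symmetric]
      linear_sum[OF matrix_vector_mul_linear, symmetric])
  show "element_stiffness D K a b \<le> 0" if ab: "a \<in> vertices K" "b \<in> vertices K" "a \<noteq> b" for a b
  proof -
    have "piece \<Omega> K \<noteq> {}"
      using measure_piece(1,2)[OF dom mesh K] by force
    then obtain x where x: "x \<in> interior K" by (auto simp: piece_def)
    have "nodal_grad K a \<bullet> (mean_diffusion D K *v nodal_grad K b) \<le> 0"
      using non ab K x unfolding nonobtuse_def vertices_def by (auto simp flip: grad_hat[OF mesh K x])
    then have "1 / measure lebesgue K * element_stiffness D K a b \<le> 0"
      by (simp add: mean_diffusion_def element_stiffness_def scaleR_matrix_vector_assoc[symmetric])
    moreover have "measure lebesgue K > 0"
      using measure_piece(2)[OF dom mesh K] mesh_compact(1)[OF mesh K] by (simp add: borel_compact)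
    ultimately show ?thesis by (simp add: divide_le_0_iff)
  qed
qed

lemma stiffness_form:
  assumes A: "\<And>i j. i < N \<Longrightarrow> j < N \<Longrightarrow> A $$ (i, j) = (\<Sum>K\<in>\<T>. element_stiffness D K (p i) (p j))"
  shows "bilin_form N A u u = (\<Sum>K\<in>\<T>. (\<Sum>i<N. u i *\<^sub>R nodal_grad K (p i)) \<bullet>
      ((LINT x:K|lebesgue. D x) *v (\<Sum>i<N. u i *\<^sub>R nodal_grad K (p i))))"
proof -
  have "bilin_form N A u u = (\<Sum>i<N. \<Sum>j<N. \<Sum>K\<in>\<T>. u i * u j * element_stiffness D K (p i) (p j))"
    unfolding bilin_form_def mat_apply_def by (simp add: A sum_distrib_left sum_distrib_right mult_ac)
  also have "\<dots> = (\<Sum>i<N. \<Sum>K\<in>\<T>. \<Sum>j<N. u i * u j * element_stiffness D K (p i) (p j))"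
    by (intro sum.cong refl sum.swap)
  also have "\<dots> = (\<Sum>K\<in>\<T>. \<Sum>i<N. \<Sum>j<N. u i * u j * element_stiffness D K (p i) (p j))"
    by (rule sum.swap)
  also have "\<dots> = (\<Sum>K\<in>\<T>. (\<Sum>i<N. u i *\<^sub>R nodal_grad K (p i)) \<bullet>
      ((LINT x:K|lebesgue. D x) *v (\<Sum>i<N. u i *\<^sub>R nodal_grad K (p i))))"
    by (intro sum.cong refl, subst inner_sum_left, intro sum.cong refl)
      (simp add: element_stiffness_def linear_sum[OF matrix_vector_mul_linear]
        inner_sum_right matrix_vector_mult_scaleR sum_distrib_left mult_ac)
  finally show ?thesis .
qed

text \<open>
  If the form vanishes at \<open>u\<close>, then the finite element function with coefficients \<open>u\<close> has zero gradient,
  so it is constant on each element.  A continuous function with finitely many values on the connected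
  set \<open>closure \<Omega>\<close> is constant, and it vanishes at the vertex \<open>b\<close> that carries no basis function.
\<close>

lemma stiffness_positive_definite:
  assumes A: "\<And>i j. i < N \<Longrightarrow> j < N \<Longrightarrow> A $$ (i, j) = (\<Sum>K\<in>\<T>. element_stiffness D K (p i) (p j))"
    and p: "inj_on p {..<N}" "p ` {..<N} \<subseteq> mesh_vertices \<T>"
    and b: "b \<in> mesh_vertices \<T>" "b \<notin> p ` {..<N}" and u: "\<exists>i<N. u i \<noteq> 0"
  shows "0 < bilin_form N A u u"
proof -
  define G where "G K = (\<Sum>i<N. u i *\<^sub>R nodal_grad K (p i))" for K
  define v where "v x = (\<Sum>i<N. u i * hat \<T> (p i) x)" for x
  let ?q = "\<lambda>K. G K \<bullet> ((LINT x:K|lebesgue. D x) *v G K)"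
  have q: "0 \<le> ?q K" "G K \<noteq> 0 \<Longrightarrow> 0 < ?q K" if "K \<in> \<T>" for K
    using element_diffusion_positive[OF dom mesh diff that, of "G K"] by (cases "G K = 0"; simp)+
  have "\<exists>K\<in>\<T>. G K \<noteq> 0"
  proof (rule ccontr)
    assume *: "\<not> (\<exists>K\<in>\<T>. G K \<noteq> 0)"
    have const: "v x = v y" if K: "K \<in> \<T>" "x \<in> K" "y \<in> K" for K x y
    proof -
      have "v x - v y = (\<Sum>i<N. u i * (nodal K (p i) x - nodal K (p i) y))"
        using hat_on_element[OF mesh K(1)] K by (simp add: v_def sum_subtractf right_diff_distrib)
      also have "\<dots> = G K \<bullet> (x - y)"
        by (simp add: nodal_diff G_def inner_sum_left)
      finally show ?thesis using * K(1) by simp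
    qed
    have "finite (v ` K)" if "K \<in> \<T>" for K
    proof (cases "K = {}")
      case False
      then obtain y where "y \<in> K" by blast
      then have "v ` K \<subseteq> {v y}" using const[OF that] by blast
      then show ?thesis using finite_subset by blast
    qed simp
    then have "finite (v ` closure \<Omega>)"
      using mesh_finite[OF mesh] by (simp add: mesh_Union[OF mesh, symmetric] image_Union)
    moreover have "continuous_on (closure \<Omega>) v"
      unfolding v_def mesh_Union[OF mesh, symmetric]
      using hat_fe[OF mesh] by (intro continuous_intros) (auto simp: fe_space_def)
    moreover have "connected (closure \<Omega>)"
      using polyhedral_domain_imp(2)[OF dom] by (rule connected_imp_connected_closure)
    ultimately have "v constant_on closure \<Omega>"
      using continuous_finite_range_constant by blast
    moreover have mv: "x \<in> closure \<Omega>" if "x \<in> mesh_vertices \<T>" for x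
      using that by (auto simp: mesh_Union[OF mesh, symmetric] mesh_vertices_def extreme_point_of_def)
    obtain i where i: "i < N" "u i \<noteq> 0" using u by blast
    have pi: "p i \<in> mesh_vertices \<T>" using p(2) i(1) by blast
    have "v b = 0"
      unfolding v_def using b(2) by (intro sum.neutral) (auto simp: hat_vertex[OF mesh b(1)])
    moreover have "v (p i) = u i"
    proof -
      have "v (p i) = (\<Sum>j<N. if j = i then u j else 0)"
        unfolding v_def using p(1) i(1)
        by (intro sum.cong) (auto simp: hat_vertex[OF mesh pi] inj_on_def)
      then show ?thesis using i(1) by simp
    qed
    ultimately show False
      using i(2) mv[OF b(1)] mv[OF pi] unfolding constant_on_def by metis
  qed
  then have "0 < (\<Sum>K\<in>\<T>. ?q K)"
    using q by (auto intro!: sum_pos2[OF mesh_finite[OF mesh]])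
  then show ?thesis using stiffness_form[of N A p u, OF A] by (simp add: G_def)
qed

end

section \<open>Eigenvalue bounds for the finite element pencil\<close>

theorem theorem3p3:
  fixes \<Omega> \<Gamma>\<^sub>D \<Gamma>\<^sub>N :: "(real^'n) set"
    and D :: "real^'n \<Rightarrow> real^'n^'n"
    and \<T> :: "(real^'n) set set"
    and N :: nat
    and p :: "nat \<Rightarrow> real^'n"
  defines "d \<equiv> real CARD('n)"
    and "\<phi> \<equiv> \<lambda>i. hat \<T> (p i)"
  defines "M \<equiv> mass_mat \<Omega> N \<phi>"
    and "Mlump \<equiv> lumped_mass_mat \<Omega> N \<phi>"
    and "A \<equiv> stiffness_mat \<Omega> D N \<phi>"
  assumes "polyhedral_domain \<Omega>"
    and "frontier \<Omega> = \<Gamma>\<^sub>D \<union> \<Gamma>\<^sub>N"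
    and "hausdorff_measure (CARD('n) - 1) \<Gamma>\<^sub>D > 0"
    and "diffusion_matrix \<Omega> D"
    and "simplicial_mesh \<Omega> \<T>"
    and "\<exists>\<F>\<subseteq>mesh_faces \<T>. \<Gamma>\<^sub>D = \<Union>\<F>"
    and "bij_betw p {..<N} (free_vertices \<T> \<Gamma>\<^sub>D)"
    and "N \<ge> 1"
  shows "\<forall>(Mt, Cgen, Cnon) \<in> {(M, 2 * (d + 1), 4), (Mlump, d + 1, 2)}.
    invertible_mat Mt \<and>
    (let B = the (mat_inverse Mt) * A in
       (\<forall>\<mu>. eigenvalue (map_mat complex_of_real B) \<mu> \<longrightarrow> \<mu> \<in> \<real> \<and> Re \<mu> > 0) \<and>
       max_diag_ratio A Mt \<le> max_eigenvalue B \<and>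
       max_eigenvalue B \<le> Cgen * max_diag_ratio A Mt \<and>
       (nonobtuse D \<T> \<longrightarrow> max_eigenvalue B \<le> Cnon * max_diag_ratio A Mt))"
proof -
  note dom = assms(6) and pos = assms(8) and diff = assms(9) and mesh = assms(10)
  have N: "N > 0" using assms(13) by simp
  have p: "inj_on p {..<N}" "p ` {..<N} = mesh_vertices \<T> - \<Gamma>\<^sub>D"
    using assms(12) unfolding bij_betw_def free_vertices_def by auto
  have fin: "finite (vertices K)" if "K \<in> \<T>" for K
    by (rule full_simplex_finite[OF mesh_element(1)[OF mesh that]])

  have car: "A \<in> carrier_mat N N" "M \<in> carrier_mat N N" "Mlump \<in> carrier_mat N N"
    by (simp_all add: A_def M_def Mlump_def stiffness_mat_def mass_mat_def lumped_mass_mat_def)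
  have A: "A $$ (i, j) = (\<Sum>K\<in>\<T>. element_stiffness D K (p i) (p j))" if "i < N" "j < N" for i j
    using that by (simp add: A_def stiffness_mat_def \<phi>_def element_stiffness_def stiffness_entry[OF dom mesh diff])
  have M: "M $$ (i, j) = (\<Sum>K\<in>\<T>. element_mass K (p i) (p j))" if "i < N" "j < N" for i j
    using that by (simp add: M_def mass_mat_def \<phi>_def mass_entry(2)[OF dom mesh])
  have lump: "Mlump $$ (i, j) = (if i = j then \<Sum>k<N. M $$ (i, k) else 0)" if "i < N" "j < N" for i j
  proof -
    have "(LINT x:\<Omega>|lebesgue. \<Sum>k<N. hat \<T> (p i) x * hat \<T> (p k) x)
        = (\<Sum>k<N. LINT x:\<Omega>|lebesgue. hat \<T> (p i) x * hat \<T> (p k) x)" for i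
      using mass_entry(1)[OF dom mesh] unfolding set_lebesgue_integral_def scaleR_sum_right set_integrable_def
      by (intro Bochner_Integration.integral_sum)
    then show ?thesis
      using that by (simp add: Mlump_def M_def lumped_mass_mat_def mass_mat_def \<phi>_def sum_distrib_left)
  qed

  have Asym: "A $$ (i, j) = A $$ (j, i)" if "i < N" "j < N" for i j
    using that by (simp add: A element_stiffness_def element_diffusion_symmetric[OF dom mesh diff] cong: sum.cong)
  have Msym: "M $$ (i, j) = M $$ (j, i)" if "i < N" "j < N" for i j
    using that by (auto simp: M element_mass_def intro!: sum.cong)
  have Lsym: "Mlump $$ (i, j) = Mlump $$ (j, i)" if "i < N" "j < N" for i j
    using that by (simp add: lump)

  obtain b where "b \<in> mesh_vertices \<T>" "b \<in> \<Gamma>\<^sub>D"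
    using dirichlet_vertex_exists[OF mesh pos assms(11)] .
  then have Apos: "0 < bilin_form N A u u" if "\<exists>i<N. u i \<noteq> 0" for u
    using stiffness_positive_definite[OF dom mesh diff A p(1) _ _ _ that, of b] p(2) by auto

  have Mpos: "0 \<le> M $$ (i, j)" if "i < N" "j < N" for i j
    using that by (auto simp: M element_mass_def intro!: sum_nonneg)
  have Mdiag: "0 < M $$ (i, i)" if "i < N" for i
  proof -
    have "p i \<in> mesh_vertices \<T>" using p(2) that by blast
    then obtain K where K: "K \<in> \<T>" "p i \<in> vertices K" unfolding mesh_vertices_eq by blast
    have "0 < element_mass K (p i) (p i)"
      using measure_piece(2)[OF dom mesh K(1)] K(2) by (simp add: element_mass_def)
    then show ?thesis
      unfolding M[OF that that] using K(1) mesh_finite[OF mesh]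
      by (intro sum_pos2[of _ K]) (auto simp: element_mass_def)
  qed
  have Ldiag: "0 < Mlump $$ (i, i)" if "i < N" for i
    using that Mpos Mdiag[OF that] by (auto simp: lump intro!: sum_pos2[of _ i])

  \<comment> \<open>Coefficients as a function on all vertices, zero on the Dirichlet part.\<close>
  define U where "U u a = (if a \<in> p ` {..<N} then u (inv_into {..<N} p a) else 0)" for u :: "nat \<Rightarrow> real" and a
  have U: "U u (p i) = u i" if "i < N" for u i
    using that p(1) by (simp add: U_def)
  have U0: "U u a = 0" if "a \<notin> p ` {..<N}" for u a
    using that by (simp add: U_def)
  have A0: "element_stiffness D K a b = 0" if "K \<in> \<T>" "a \<notin> vertices K \<or> b \<notin> vertices K" for K a b
    using that(2) by (auto simp: element_stiffness_def nodal_grad_def)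
  have M0: "element_mass K a b = 0" if "K \<in> \<T>" "a \<notin> vertices K \<or> b \<notin> vertices K" for K a b
    using that(2) by (auto simp: element_mass_def)
  have Aform: "bilin_form N A u u = (\<Sum>K\<in>\<T>. \<Sum>a\<in>vertices K. \<Sum>b\<in>vertices K. U u a * U u b * element_stiffness D K a b)"
    "(\<Sum>i<N. A $$ (i, i) * (u i)\<^sup>2) = (\<Sum>K\<in>\<T>. \<Sum>a\<in>vertices K. (U u a)\<^sup>2 * element_stiffness D K a a)" for u
    using bilin_form_assembled[where p = p and \<T> = \<T> and V = vertices and e = "element_stiffness D" and U = "U u" and u = u,
      OF p(1) fin A A0 U U0] by blast+
  have Mform: "bilin_form N M u u = (\<Sum>K\<in>\<T>. \<Sum>a\<in>vertices K. \<Sum>b\<in>vertices K. U u a * U u b * element_mass K a b)"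
    "(\<Sum>i<N. M $$ (i, i) * (u i)\<^sup>2) = (\<Sum>K\<in>\<T>. \<Sum>a\<in>vertices K. (U u a)\<^sup>2 * element_mass K a a)" for u
    using bilin_form_assembled[where p = p and \<T> = \<T> and V = vertices and e = element_mass and U = "U u" and u = u,
      OF p(1) fin M M0 U U0] by blast+

  have Agen: "bilin_form N A u u \<le> (d + 1) * (\<Sum>i<N. A $$ (i, i) * (u i)\<^sup>2)" for u
    unfolding Aform d_def sum_distrib_left[of _ _ \<T>]
    by (intro sum_mono element_stiffness_bound[OF dom mesh diff])
  have Anon: "bilin_form N A u u \<le> 2 * (\<Sum>i<N. A $$ (i, i) * (u i)\<^sup>2)" if "nonobtuse D \<T>" for u
    unfolding Aform sum_distrib_left[of _ _ \<T>]
    by (intro sum_mono element_stiffness_bound_nonobtuse[OF dom mesh diff _ that])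
  have Mlow: "1 / 2 * (\<Sum>i<N. M $$ (i, i) * (u i)\<^sup>2) \<le> bilin_form N M u u" for u
    unfolding Mform sum_distrib_left[of _ _ \<T>]
    by (intro sum_mono element_mass_bound[OF mesh])
  have Llow: "1 * (\<Sum>i<N. Mlump $$ (i, i) * (u i)\<^sup>2) \<le> bilin_form N Mlump u u" for u
    by (simp add: bilin_form_def mat_apply_def lump if_distrib if_distribR power2_eq_square mult_ac cong: if_cong)

  have bounds: "invertible_mat X \<and>
    (let B = the (mat_inverse X) * A in
       (\<forall>\<mu>. eigenvalue (map_mat complex_of_real B) \<mu> \<longrightarrow> \<mu> \<in> \<real> \<and> Re \<mu> > 0) \<and>
       max_diag_ratio A X \<le> max_eigenvalue B \<and>
       max_eigenvalue B \<le> Cgen * max_diag_ratio A X \<and>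
       (nonobtuse D \<T> \<longrightarrow> max_eigenvalue B \<le> Cnon * max_diag_ratio A X))"
    if X: "X \<in> carrier_mat N N" "\<And>i j. i < N \<Longrightarrow> j < N \<Longrightarrow> X $$ (i, j) = X $$ (j, i)"
        "\<And>i. i < N \<Longrightarrow> 0 < X $$ (i, i)"
      and c: "c > 0" "\<And>u. c * (\<Sum>i<N. X $$ (i, i) * (u i)\<^sup>2) \<le> bilin_form N X u u"
      and C: "Cgen = (d + 1) / c" "Cnon = 2 / c"
    for X c Cgen Cnon
  proof -
    note gen = generalized_eigenvalue_bounds[of N A X c, OF N car(1) X(1) Asym X(2) Apos X(3) c]
    have "max_eigenvalue (the (mat_inverse X) * A) \<le> Cgen * max_diag_ratio A X"
      unfolding C by (rule gen(4)) (use Agen in \<open>auto simp: d_def\<close>)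
    moreover have "max_eigenvalue (the (mat_inverse X) * A) \<le> Cnon * max_diag_ratio A X" if "nonobtuse D \<T>"
      unfolding C by (rule gen(4)) (use Anon[OF that] in auto)
    ultimately show ?thesis
      unfolding Let_def using gen(1-3) by blast
  qed
  show ?thesis
    using bounds[OF car(2) Msym Mdiag _ Mlow, of "2 * (d + 1)" 4]
      bounds[OF car(3) Lsym Ldiag _ Llow, of "d + 1" 2] by simp
qed

end
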